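(* Let $\boldsymbol{\zeta}=(\zeta_1,\ldots,\zeta_{k+1})$ be a perturbed chi-square risk with parameters $\rho_1,\ldots,\rho_k\in\mathbb{R}\setminus\{0\}$ satisfying Assumption A (all defined in the context), and let $\boldsymbol{U}=(U_1,\ldots,U_k)$ have the same distribution as the centered Gaussian random vector $\boldsymbol{W}=(W_1,\ldots,W_k)$. Then, as $v\to\infty$, $$\left(\frac{\zeta_2-\rho_1^2v}{2\rho_1\sqrt v},\ldots,\frac{\zeta_{k+1}-\rho_k^2v}{2\rho_k\sqrt v}\right)\Big|\,(\zeta_1=v)\ \xrightarrow{d}\ \boldsymbol{U}.$$ Further, if the distribution function $G$ of $\zeta_1$ is in the Gumbel max-domain of attraction with some positive scaling function $w(\cdot)$, i.e. $$\lim_{v\to\infty}\frac{1-G(v+x/w(v))}{1-G(v)}=\exp(-x),\qquad x\in\mathbb{R},$$ and $$\lim_{v\to\infty}(\sqrt v\,w(v))^{-1}=2c\in[0,\infty),$$ then, as $v\to\infty$, $$\left(w(v)(\zeta_1-v),\frac{\zeta_2-\rho_1^2v}{2\rho_1\sqrt v},\ldots,\frac{\zeta_{k+1}-\rho_k^2v}{2\rho_k\sqrt v}\right)\Big|\,(\zeta_1>v)\ \xrightarrow{d}\ (E,\ \rho_1cE+U_1,\ldots,\rho_kcE+U_k),$$ where $E$ is a unit exponential random variable independent of $\boldsymbol{U}$.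
   Context: Let $m\ge2$ and $k\ge1$ be fixed integers. Perturbed chi-square risk: for $1\le i\le m$ let $(X_{i1},\ldots,X_{i(k+1)})$ be $(k+1)$-dimensional random vectors with the stochastic representation $$(X_{i1},\ldots,X_{i(k+1)})\overset{d}{=}(X_{i1},\ \rho_1X_{i1}+W_{i1},\ldots,\rho_kX_{i1}+W_{ik}),\quad 1\le i\le m,$$ where $\rho_j\in\mathbb{R}\setminus\{0\}$, $1\le j\le k$, and $\mathcal{W}=\{W_{ij}\}_{1\le i\le m,1\le j\le k}$ is an $m\times k$ matrix of centered (not necessarily standard) Gaussian random variables. The $(k+1)$-dimensional perturbed chi-square risk is $\boldsymbol{\zeta}=(\zeta_1,\ldots,\zeta_{k+1})$ with $\zeta_j=\sum_{i=1}^mX_{ij}^2$, $1\le j\le k+1$. Assumption A: the random vector $(X_{11},\ldots,X_{m1})$ and the Gaussian random matrix $\mathcal{W}$ are mutually independent; the rows of $\mathcal{W}$ are independent and each has the same distribution as a centered $k$-dimensional Gaussian random vector $\boldsymbol{W}=(W_1,\ldots,W_k)$; and $\zeta_1$ has a continuous distribution function $G$ which has support on $[0,\infty)$. (The variables $X_{11},\ldots,X_{m1}$ are not assumed independent or Gaussian.) The notation $\boldsymbol{Y}_v\,|\,(A_v)\xrightarrow{d}\boldsymbol{Y}$ means that random vectors having the conditional distribution of $\boldsymbol{Y}_v$ given $A_v$ converge in distribution to $\boldsymbol{Y}$ as $v\to\infty$. *)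

theory Defs
  imports "HOL-Probability.Probability"
begin

text \<open>
  Vectors in $R^{k+1}$ have index type \<open>'k option\<close>: position 1 is \<open>None\<close> and position
  \<open>j + 1\<close> is \<open>Some j\<close>.
\<close>

definition vec_cons :: "real \<Rightarrow> real^'k \<Rightarrow> real^('k::finite option)" where
  "vec_cons a x = (\<chi> j. case j of None \<Rightarrow> a | Some l \<Rightarrow> x $ l)"

definition vec_tl :: "real^('k::finite option) \<Rightarrow> real^'k" where
  "vec_tl x = (\<chi> l. x $ Some l)"

text \<open>
  Convergence in distribution of the laws \<open>\<mu> v\<close> along a filter on the index set. (The library's
  \<open>weak_conv_m\<close> covers only sequences of measures on the real line.)
\<close>

definition converges_weakly ::
    "('i \<Rightarrow> 'a::topological_space measure) \<Rightarrow> 'a measure \<Rightarrow> 'i filter \<Rightarrow> bool" where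
  "converges_weakly \<mu> \<nu> F \<longleftrightarrow>
     (\<forall>f::'a \<Rightarrow> real. continuous_on UNIV f \<and> bounded (range f) \<longrightarrow>
        ((\<lambda>v. \<integral>x. f x \<partial>\<mu> v) \<longlongrightarrow> (\<integral>x. f x \<partial>\<nu>)) F)"

text \<open>
  \<open>\<kappa>\<close> is a regular conditional distribution of \<open>Y\<close> given \<open>Z\<close>; \<open>\<kappa> v\<close> is the conditional law
  of \<open>Y\<close> given \<open>Z = v\<close>.
\<close>

definition regular_cond_distr ::
    "'w measure \<Rightarrow> ('w \<Rightarrow> real) \<Rightarrow> ('w \<Rightarrow> 'b::topological_space) \<Rightarrow> (real \<Rightarrow> 'b measure) \<Rightarrow> bool" where
  "regular_cond_distr M Z Y \<kappa> \<longleftrightarrow>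
     \<kappa> \<in> borel \<rightarrow>\<^sub>M prob_algebra borel \<and>
     (\<forall>A\<in>sets borel. \<forall>B\<in>sets borel.
        emeasure M {\<omega>\<in>space M. Z \<omega> \<in> A \<and> Y \<omega> \<in> B} =
        (\<integral>\<^sup>+v\<in>A. emeasure (\<kappa> v) B \<partial>distr M borel Z))"

text \<open>
  \<open>T v Y | (Z = v)\<close> converges in distribution to \<open>L\<close> as \<open>v \<rightarrow> \<infinity>\<close>. The events \<open>Z = v\<close> may be
  null, and conditional laws given \<open>Z = v\<close> are determined only up to a null set of values \<open>v\<close>
  for the law of \<open>Z\<close>. So the requirement is that regular conditional distributions exist and that
  each of them converges as \<open>v \<rightarrow> \<infinity>\<close> outside such a null set.
\<close>

definition converges_given_value ::
    "'w measure \<Rightarrow> ('w \<Rightarrow> real) \<Rightarrow> ('w \<Rightarrow> 'b::topological_space) \<Rightarrow>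
     (real \<Rightarrow> 'b \<Rightarrow> 'c::topological_space) \<Rightarrow> 'c measure \<Rightarrow> bool" where
  "converges_given_value M Z Y T L \<longleftrightarrow>
     (\<exists>\<kappa>. regular_cond_distr M Z Y \<kappa>) \<and>
     (\<forall>\<kappa>. regular_cond_distr M Z Y \<kappa> \<longrightarrow>
        (\<exists>S\<in>null_sets (distr M borel Z).
           converges_weakly (\<lambda>v. distr (\<kappa> v) borel (T v)) L (inf at_top (principal (- S)))))"

text \<open>
  \<open>Y v | (Z > v)\<close> converges in distribution to \<open>L\<close> as \<open>v \<rightarrow> \<infinity>\<close>; \<open>uniform_measure M A\<close> is the
  conditional probability measure given \<open>A\<close>.
\<close>

definition converges_given_exceedance ::
    "'w measure \<Rightarrow> ('w \<Rightarrow> real) \<Rightarrow> (real \<Rightarrow> 'w \<Rightarrow> 'c::topological_space) \<Rightarrow> 'c measure \<Rightarrow> bool" where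
  "converges_given_exceedance M Z Y L \<longleftrightarrow>
     converges_weakly
       (\<lambda>v. distr (uniform_measure M {\<omega>\<in>space M. v < Z \<omega>}) borel (Y v)) L at_top"

text \<open>
  Centered Gaussian laws: every one-dimensional projection is the law of \<open>\<sigma> * \<xi>\<close> with \<open>\<xi>\<close> standard
  normal. The covariance may be singular (\<open>\<sigma> = 0\<close> is allowed).
\<close>

definition centered_gaussian :: "'a::euclidean_space measure \<Rightarrow> bool" where
  "centered_gaussian \<mu> \<longleftrightarrow>
     prob_space \<mu> \<and> sets \<mu> = sets borel \<and>
     (\<forall>a. \<exists>\<sigma>\<ge>0. distr \<mu> borel (\<lambda>x. a \<bullet> x) =
                 distr std_normal_distribution borel (\<lambda>x. \<sigma> * x))"

text \<open>
  Independence of two random vectors: the events they generate are independent. (The library's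
  \<open>indep_var\<close> requires both to take values in the same type.)
\<close>

definition indep_vectors ::
    "'w measure \<Rightarrow> ('w \<Rightarrow> 'a::topological_space) \<Rightarrow> ('w \<Rightarrow> 'b::topological_space) \<Rightarrow> bool" where
  "indep_vectors M Y Z \<longleftrightarrow>
     prob_space.indep_set M {Y -` A \<inter> space M | A. A \<in> sets borel}
                            {Z -` B \<inter> space M | B. B \<in> sets borel}"

definition measure_support :: "'a::topological_space measure \<Rightarrow> 'a set" where
  "measure_support \<mu> = {x. \<forall>U. open U \<and> x \<in> U \<longrightarrow> emeasure \<mu> U > 0}"

text \<open>
  \<open>X \<omega> $ i\<close> is the \<open>i\<close>-th random vector; its entry \<open>None\<close> is $X_{i1}$ and its entry \<open>Some j\<close> is
  $X_{i(j+1)}$. The equality in distribution is that of the whole families indexed by \<open>i\<close>: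
  equality separately for each \<open>i\<close> would leave the joint law of the rows, hence the law of the
  sums below, undetermined.
\<close>

definition perturbed_representation ::
    "'w measure \<Rightarrow> real^'k \<Rightarrow> ('w \<Rightarrow> real^('k::finite option)^'m::finite) \<Rightarrow>
     ('w \<Rightarrow> real^'k^'m) \<Rightarrow> bool" where
  "perturbed_representation M \<rho> X W \<longleftrightarrow>
     prob_space M \<and> X \<in> borel_measurable M \<and> W \<in> borel_measurable M \<and>
     (\<forall>j. \<rho> $ j \<noteq> 0) \<and>
     (\<forall>i j. centered_gaussian (distr M borel (\<lambda>\<omega>. W \<omega> $ i $ j))) \<and>
     distr M borel X =
     distr M borel (\<lambda>\<omega>. \<chi> i. vec_cons (X \<omega> $ i $ None)
                                     (\<chi> j. \<rho> $ j * X \<omega> $ i $ None + W \<omega> $ i $ j))"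

definition chi_square_risk ::
    "('w \<Rightarrow> real^('k::finite option)^'m::finite) \<Rightarrow> 'w \<Rightarrow> real^('k option)" where
  "chi_square_risk X \<omega> = (\<chi> j. \<Sum>i\<in>UNIV. (X \<omega> $ i $ j)\<^sup>2)"

definition risk_cdf ::
    "'w measure \<Rightarrow> ('w \<Rightarrow> real^('k::finite option)^'m::finite) \<Rightarrow> real \<Rightarrow> real" where
  "risk_cdf M X = cdf (distr M borel (\<lambda>\<omega>. chi_square_risk X \<omega> $ None))"

text \<open>\<open>\<gamma>\<close> is the law of the Gaussian vector $(W_1, \ldots, W_k)$.\<close>

definition assumption_A ::
    "'w measure \<Rightarrow> (real^'k) measure \<Rightarrow> ('w \<Rightarrow> real^('k::finite option)^'m::finite) \<Rightarrow>
     ('w \<Rightarrow> real^'k^'m) \<Rightarrow> bool" where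
  "assumption_A M \<gamma> X W \<longleftrightarrow>
     indep_vectors M (\<lambda>\<omega>. \<chi> i. X \<omega> $ i $ None) W \<and>
     prob_space.indep_vars M (\<lambda>_. borel) (\<lambda>i \<omega>. W \<omega> $ i) UNIV \<and>
     centered_gaussian \<gamma> \<and>
     (\<forall>i. distr M borel (\<lambda>\<omega>. W \<omega> $ i) = \<gamma>) \<and>
     continuous_on UNIV (risk_cdf M X) \<and>
     measure_support (distr M borel (\<lambda>\<omega>. chi_square_risk X \<omega> $ None)) \<subseteq> {0..}"

definition normalize_risk :: "real^'k \<Rightarrow> real \<Rightarrow> real^'k \<Rightarrow> real^'k::finite" where
  "normalize_risk \<rho> v y = (\<chi> j. (y $ j - (\<rho> $ j)\<^sup>2 * v) / (2 * \<rho> $ j * sqrt v))"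

definition gumbel_mda :: "(real \<Rightarrow> real) \<Rightarrow> (real \<Rightarrow> real) \<Rightarrow> bool" where
  "gumbel_mda G w \<longleftrightarrow>
     (\<forall>v>0. w v > 0) \<and>
     (\<forall>x. ((\<lambda>v. (1 - G (v + x / w v)) / (1 - G v)) \<longlongrightarrow> exp (- x)) at_top)"

end

theory Submission
  imports Defs
begin

text \<open>
  Let \<open>r\<close> be the first column of \<open>X\<close> and \<open>Z = \<zeta>\<^sub>1\<close> its squared norm. Up to equality in law,
  coordinate \<open>j + 1\<close> of the risk is the squared norm of \<open>\<rho>\<^sub>j r + w\<^sub>j\<close>, where \<open>w\<^sub>j\<close> is column \<open>j\<close> of the
  noise \<open>W\<close>. Rotating \<open>r\<close> onto a coordinate axis and rotating all columns of \<open>W\<close> by the same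
  orthogonal matrix changes none of these norms. It does not change the law of \<open>W\<close> either, because the rows of \<open>W\<close> are
  independent copies of one centered Gaussian vector (\<open>gaussian_rows_rotation_invariant\<close>). So the direction of \<open>r\<close>,
  whose law is arbitrary, disappears: with \<open>Z\<close> independent of \<open>W\<close> and \<open>i\<close> any fixed row,
  jointly in law (\<open>joint_law_radial\<close>)

    \<open>\<zeta>\<^sub>j\<^sub>+\<^sub>1 = \<rho>\<^sub>j\<^sup>2 Z + 2 \<rho>\<^sub>j sqrt Z W\<^sub>i\<^sub>j + \<Sum>\<^sub>l W\<^sub>l\<^sub>j\<^sup>2\<close>.

  Invariance of the law of \<open>W\<close> follows from its characteristic function, and so from the uniqueness
  theorem in several dimensions (\<open>characteristic_function_unique\<close>). That theorem is derived from the one on the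
  real line, one coordinate at a time.

  Fixing \<open>Z = v\<close> in the formula gives a regular conditional distribution explicitly; any other one
  agrees with it outside a null set. Its normalization is row \<open>i\<close> of \<open>W\<close> plus a term of order
  \<open>1 / sqrt v\<close>, which gives the first claim by dominated convergence.

  Given \<open>Z > v\<close>, the noise is still independent of \<open>Z\<close>, and the Gumbel condition implies that the scaled
  overshoot \<open>e = w(v) (Z - v)\<close> tends in law to \<open>E\<close>. Substituting \<open>Z = v + e / w(v)\<close>, the normalized
  coordinate is

    \<open>\<rho>\<^sub>j e / (2 sqrt v w(v)) + sqrt (1 + e / (v w(v))) W\<^sub>i\<^sub>j + \<Sum>\<^sub>l W\<^sub>l\<^sub>j\<^sup>2 / (2 \<rho>\<^sub>j sqrt v)\<close>,

  and it tends to \<open>\<rho>\<^sub>j c e + W\<^sub>i\<^sub>j\<close> whenever \<open>e\<close> converges. Skorohod's representation of \<open>e\<close> turns this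
  into convergence in law (\<open>weak_conv_m_product_integral\<close>).
\<close>

section \<open>Uniqueness of characteristic functions on Euclidean spaces\<close>

text \<open>
  After division by its total mass, if that is not zero, \<open>h\<close> is a probability density, and the hypothesis says that
  \<open>g\<close> has the same characteristic function under the two tilted measures. So the real-line uniqueness
  theorem applies. A nonnegative weight is needed because that theorem is about probability laws only.
\<close>
lemma indicator_determined_by_weighted_char:
  fixes g h :: "'a \<Rightarrow> real"
  assumes "prob_space \<mu>" "prob_space \<nu>" and sets: "sets \<nu> = sets \<mu>"
    and g[measurable]: "g \<in> borel_measurable \<mu>" and h[measurable]: "h \<in> borel_measurable \<mu>"
    and h0: "\<And>x. 0 \<le> h x" and hC: "\<And>x. h x \<le> C"
    and eq: "\<And>t. (\<integral>x. h x *\<^sub>R iexp (t * g x) \<partial>\<mu>) = (\<integral>x. h x *\<^sub>R iexp (t * g x) \<partial>\<nu>)"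
    and B[measurable]: "B \<in> sets borel"
  shows "(\<integral>x. h x * indicator B (g x) \<partial>\<mu>) = (\<integral>x. h x * indicator B (g x) \<partial>\<nu>)"
proof -
  interpret \<mu>: prob_space \<mu> by fact
  interpret \<nu>: prob_space \<nu> by fact
  have [measurable]: "g \<in> borel_measurable \<nu>" "h \<in> borel_measurable \<nu>"
    using sets by (auto cong: measurable_cong_sets)
  have int\<mu>: "integrable \<mu> h"
    by (rule \<mu>.integrable_const_bound[where B=C]) (use h0 hC in auto)
  have int\<nu>: "integrable \<nu> h"
    by (rule \<nu>.integrable_const_bound[where B=C]) (use h0 hC in auto)
  define p where "p = (\<integral>x. h x \<partial>\<mu>)"
  have "complex_of_real (\<integral>x. h x \<partial>\<mu>) = complex_of_real (\<integral>x. h x \<partial>\<nu>)"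
    using eq[of 0] by (simp add: scaleR_conv_of_real)
  then have p\<nu>: "p = (\<integral>x. h x \<partial>\<nu>)" by (simp add: p_def)
  have p0: "p \<ge> 0" unfolding p_def using h0 by (auto intro: integral_nonneg_AE)
  show ?thesis
  proof (cases "p = 0")
    case True
    have "AE x in \<mu>. h x = 0"
      using integral_nonneg_eq_0_iff_AE[OF int\<mu>] h0 True p_def by auto
    moreover have "AE x in \<nu>. h x = 0"
      using integral_nonneg_eq_0_iff_AE[OF int\<nu>] h0 True p\<nu> by auto
    ultimately have "(\<integral>x. h x * indicator B (g x) \<partial>\<mu>) = 0" "(\<integral>x. h x * indicator B (g x) \<partial>\<nu>) = 0"
      by (auto intro!: integral_eq_zero_AE)
    then show ?thesis by simp
  next
    case False
    with p0 have p: "p > 0" by simp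
    have *: "real_distribution (distr (density \<kappa> (\<lambda>x. ennreal (h x / p))) borel g) \<and>
       char (distr (density \<kappa> (\<lambda>x. ennreal (h x / p))) borel g) = (\<lambda>t. (\<integral>x. h x *\<^sub>R iexp (t * g x) \<partial>\<kappa>) / p) \<and>
       measure (distr (density \<kappa> (\<lambda>x. ennreal (h x / p))) borel g) B = (\<integral>x. h x * indicator B (g x) \<partial>\<kappa>) / p"
      if [measurable]: "g \<in> borel_measurable \<kappa>" "h \<in> borel_measurable \<kappa>" and int: "integrable \<kappa> h" "(\<integral>x. h x \<partial>\<kappa>) = p" 
      for \<kappa> :: "'a measure"
    proof -
      let ?D = "density \<kappa> (\<lambda>x. ennreal (h x / p))"
      have "emeasure ?D (space ?D) = (\<integral>\<^sup>+x. ennreal (h x / p) \<partial>\<kappa>)"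
        by (subst emeasure_density) (auto intro!: nn_integral_cong)
      also have "\<dots> = ennreal (\<integral>x. h x / p \<partial>\<kappa>)"
        by (rule nn_integral_eq_integral) (use int h0 p in auto)
      also have "\<dots> = 1" using int p by simp
      finally interpret D: prob_space ?D by (rule prob_spaceI)
      interpret R: prob_space "distr ?D borel g" by (rule D.prob_space_distr) simp
      have "real_distribution (distr ?D borel g)"
        by (simp add: real_distribution_def real_distribution_axioms_def R.prob_space_axioms)
      moreover have "char (distr ?D borel g) = (\<lambda>t. (\<integral>x. h x *\<^sub>R iexp (t * g x) \<partial>\<kappa>) / p)"
      proof
        fix t
        have "char (distr ?D borel g) t = (\<integral>x. iexp (t * g x) \<partial>?D)"
          unfolding char_def by (subst integral_distr) auto
        also have "\<dots> = (\<integral>x. (h x / p) *\<^sub>R iexp (t * g x) \<partial>\<kappa>)"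
          by (subst integral_density) (use h0 p in auto)
        also have "\<dots> = (\<integral>x. (h x *\<^sub>R iexp (t * g x)) / p \<partial>\<kappa>)"
          by (intro Bochner_Integration.integral_cong) (auto simp: scaleR_conv_of_real)
        also have "\<dots> = (\<integral>x. h x *\<^sub>R iexp (t * g x) \<partial>\<kappa>) / p"
          by (rule integral_divide_zero)
        finally show "char (distr ?D borel g) t = (\<integral>x. h x *\<^sub>R iexp (t * g x) \<partial>\<kappa>) / p" .
      qed
      moreover have "measure (distr ?D borel g) B = (\<integral>x. h x * indicator B (g x) \<partial>\<kappa>) / p"
      proof -
        have "measure (distr ?D borel g) B = (\<integral>x. indicator B x \<partial>(distr ?D borel g))"
          by simp
        also have "\<dots> = (\<integral>x. indicator B (g x) \<partial>?D)"
          by (subst integral_distr) auto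
        also have "\<dots> = (\<integral>x. (h x / p) *\<^sub>R indicator B (g x) \<partial>\<kappa>)"
          by (subst integral_density) (use h0 p in auto)
        finally show ?thesis by simp
      qed
      ultimately show ?thesis by blast
    qed
    have "distr (density \<mu> (\<lambda>x. ennreal (h x / p))) borel g = distr (density \<nu> (\<lambda>x. ennreal (h x / p))) borel g"
      by (rule Levy_uniqueness) (use *[of \<mu>] *[of \<nu>] int\<mu> int\<nu> p_def p\<nu> eq in auto)
    then have "(\<integral>x. h x * indicator B (g x) \<partial>\<mu>) / p = (\<integral>x. h x * indicator B (g x) \<partial>\<nu>) / p"
      using *[of \<mu>] *[of \<nu>] int\<mu> int\<nu> p_def p\<nu> by (metis \<open>g \<in> borel_measurable \<nu>\<close> \<open>h \<in> borel_measurable \<nu>\<close> g h)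
    then show ?thesis using p by simp
  qed
qed

text \<open>
  This is the induction step for uniqueness in higher dimension: equality of the Fourier transforms
  restricted to \<open>D\<close> is inherited by \<open>D\<close> cut with a slab in direction \<open>a\<close>. The integrand
  \<open>exp(i t \<bullet> x)\<close> is not a nonnegative weight, but \<open>1 + cos (t \<bullet> x)\<close> and \<open>1 + sin (t \<bullet> x)\<close> are, and
  multiplying them by \<open>exp(i \<tau> a \<bullet> x)\<close> gives exponentials with frequencies \<open>\<tau> a\<close> and \<open>\<tau> a \<plusminus> t\<close>,
  which the hypothesis covers.
\<close>
lemma char_equality_restrict:
  fixes \<mu> \<nu> :: "'a::euclidean_space measure"
  assumes "prob_space \<mu>" "prob_space \<nu>" and s1: "sets \<mu> = sets borel" and s2: "sets \<nu> = sets borel"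
    and D[measurable]: "D \<in> sets borel"
    and eq: "\<And>t. (\<integral>x. indicator D x *\<^sub>R iexp (t \<bullet> x) \<partial>\<mu>) = (\<integral>x. indicator D x *\<^sub>R iexp (t \<bullet> x) \<partial>\<nu>)"
    and B[measurable]: "B \<in> sets borel"
  shows "(\<integral>x. indicator (D \<inter> {x. a \<bullet> x \<in> B}) x *\<^sub>R iexp (t \<bullet> x) \<partial>\<mu>)
       = (\<integral>x. indicator (D \<inter> {x. a \<bullet> x \<in> B}) x *\<^sub>R iexp (t \<bullet> x) \<partial>\<nu>)"
proof -
  interpret \<mu>: prob_space \<mu> by fact
  interpret \<nu>: prob_space \<nu> by fact
  note [measurable_cong] = s1 s2
  have P: "prob_space \<kappa>" "sets \<kappa> = sets borel" if "\<kappa> \<in> {\<mu>,\<nu>}" for \<kappa> using that assms by auto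
  define F where "F \<kappa> s = (\<integral>x. indicator D x *\<^sub>R iexp (s \<bullet> x) \<partial>\<kappa>)" for \<kappa> :: "'a measure" and s
  have Feq: "F \<mu> s = F \<nu> s" for s using eq F_def by simp
  have I: "integrable \<kappa> (\<lambda>x. indicator D x *\<^sub>R iexp (s \<bullet> x))" if "\<kappa> \<in> {\<mu>,\<nu>}" for \<kappa> s
  proof -
    interpret prob_space \<kappa> using P that by blast
    note [measurable_cong] = P(2)[OF that]
    show ?thesis
      by (rule integrable_const_bound[where B=1]) (auto split: split_indicator)
  qed
  have c: "(\<integral>x. (indicator D x * (1 + cos (t \<bullet> x))) *\<^sub>R iexp (\<tau> * (a \<bullet> x)) \<partial>\<kappa>)
     = F \<kappa> (\<tau> *\<^sub>R a) + (F \<kappa> (\<tau> *\<^sub>R a + t) + F \<kappa> (\<tau> *\<^sub>R a - t)) / 2" if k: "\<kappa> \<in> {\<mu>,\<nu>}" for \<kappa> \<tau> t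
  proof -
    have "(indicator D x * (1 + cos (t \<bullet> x))) *\<^sub>R iexp (\<tau> * (a \<bullet> x)) =
       indicator D x *\<^sub>R iexp ((\<tau> *\<^sub>R a) \<bullet> x) + (indicator D x *\<^sub>R iexp ((\<tau> *\<^sub>R a + t) \<bullet> x)
         + indicator D x *\<^sub>R iexp ((\<tau> *\<^sub>R a - t) \<bullet> x)) / 2" for x
      by (auto simp: scaleR_conv_of_real inner_add_left inner_diff_left distrib_left right_diff_distrib
          exp_add exp_diff exp_Euler complex_eq_iff field_simps split: split_indicator)
         (auto simp: complex_eq_iff exp_Euler cos_of_real sin_of_real field_simps Re_divide Im_divide power2_eq_square)
    then have "(\<integral>x. (indicator D x * (1 + cos (t \<bullet> x))) *\<^sub>R iexp (\<tau> * (a \<bullet> x)) \<partial>\<kappa>)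
      = (\<integral>x. indicator D x *\<^sub>R iexp ((\<tau> *\<^sub>R a) \<bullet> x) + (indicator D x *\<^sub>R iexp ((\<tau> *\<^sub>R a + t) \<bullet> x)
         + indicator D x *\<^sub>R iexp ((\<tau> *\<^sub>R a - t) \<bullet> x)) / 2 \<partial>\<kappa>)" by (intro Bochner_Integration.integral_cong) auto
    also have "\<dots> = F \<kappa> (\<tau> *\<^sub>R a) + (F \<kappa> (\<tau> *\<^sub>R a + t) + F \<kappa> (\<tau> *\<^sub>R a - t)) / 2"
      unfolding F_def
      by (subst Bochner_Integration.integral_add, rule I[OF k], intro integrable_divide_zero impI Bochner_Integration.integrable_add I[OF k],
          subst integral_divide_zero, subst Bochner_Integration.integral_add, rule I[OF k], rule I[OF k], rule refl)
    finally show ?thesis .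
  qed
  have s: "(\<integral>x. (indicator D x * (1 + sin (t \<bullet> x))) *\<^sub>R iexp (\<tau> * (a \<bullet> x)) \<partial>\<kappa>)
     = F \<kappa> (\<tau> *\<^sub>R a) + (F \<kappa> (\<tau> *\<^sub>R a + t) - F \<kappa> (\<tau> *\<^sub>R a - t)) / (2 * \<i>)" if k: "\<kappa> \<in> {\<mu>,\<nu>}" for \<kappa> \<tau> t
  proof -
    have "(indicator D x * (1 + sin (t \<bullet> x))) *\<^sub>R iexp (\<tau> * (a \<bullet> x)) =
       indicator D x *\<^sub>R iexp ((\<tau> *\<^sub>R a) \<bullet> x) + (indicator D x *\<^sub>R iexp ((\<tau> *\<^sub>R a + t) \<bullet> x)
         - indicator D x *\<^sub>R iexp ((\<tau> *\<^sub>R a - t) \<bullet> x)) / (2 * \<i>)" for x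
      by (auto simp: scaleR_conv_of_real inner_add_left inner_diff_left distrib_left right_diff_distrib
          exp_add exp_diff exp_Euler complex_eq_iff field_simps split: split_indicator)
         (auto simp: complex_eq_iff exp_Euler cos_of_real sin_of_real field_simps Re_divide Im_divide power2_eq_square)
    then have "(\<integral>x. (indicator D x * (1 + sin (t \<bullet> x))) *\<^sub>R iexp (\<tau> * (a \<bullet> x)) \<partial>\<kappa>)
      = (\<integral>x. indicator D x *\<^sub>R iexp ((\<tau> *\<^sub>R a) \<bullet> x) + (indicator D x *\<^sub>R iexp ((\<tau> *\<^sub>R a + t) \<bullet> x)
         - indicator D x *\<^sub>R iexp ((\<tau> *\<^sub>R a - t) \<bullet> x)) / (2 * \<i>) \<partial>\<kappa>)" by (intro Bochner_Integration.integral_cong) auto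
    also have "\<dots> = F \<kappa> (\<tau> *\<^sub>R a) + (F \<kappa> (\<tau> *\<^sub>R a + t) - F \<kappa> (\<tau> *\<^sub>R a - t)) / (2 * \<i>)"
      unfolding F_def
      by (subst Bochner_Integration.integral_add, rule I[OF k], intro integrable_divide_zero impI Bochner_Integration.integrable_diff I[OF k],
          subst integral_divide_zero, subst Bochner_Integration.integral_diff, rule I[OF k], rule I[OF k], rule refl)
    finally show ?thesis .
  qed
  have w: "(\<integral>x. (indicator D x * (1 + u x)) * indicator B (a \<bullet> x) \<partial>\<mu>) = (\<integral>x. (indicator D x * (1 + u x)) * indicator B (a \<bullet> x) \<partial>\<nu>)"
    if u: "u = (\<lambda>x. cos (t \<bullet> x)) \<or> u = (\<lambda>x. sin (t \<bullet> x))" for t and u :: "'a \<Rightarrow> real"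
  proof (rule indicator_determined_by_weighted_char[where C=2])
    have u1: "0 \<le> 1 + u x \<and> 1 + u x \<le> 2" for x 
      using u sin_ge_minus_one[of "t \<bullet> x"] cos_ge_minus_one[of "t \<bullet> x"] sin_le_one[of "t \<bullet> x"] cos_le_one[of "t \<bullet> x"]
      by (elim disjE; simp only:; linarith)
    show "0 \<le> indicator D x * (1 + u x)" "indicator D x * (1 + u x) \<le> 2" for x 
      using u1[of x] by (auto split: split_indicator)
    show "(\<lambda>x. indicator D x * (1 + u x)) \<in> borel_measurable \<mu>" using u by auto
    show "(\<integral>x. (indicator D x * (1 + u x)) *\<^sub>R iexp (\<tau> * (a \<bullet> x)) \<partial>\<mu>) = (\<integral>x. (indicator D x * (1 + u x)) *\<^sub>R iexp (\<tau> * (a \<bullet> x)) \<partial>\<nu>)" for \<tau>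
      using u c[of \<mu> t \<tau>] c[of \<nu> t \<tau>] s[of \<mu> t \<tau>] s[of \<nu> t \<tau>] Feq by fastforce
  qed (use assms in auto)
  have ib: "integrable \<kappa> (\<lambda>x. indicator D x * u x * indicator B (a \<bullet> x))"
    if k: "\<kappa> \<in> {\<mu>,\<nu>}" and u: "u \<in> borel_measurable borel" "\<And>x. \<bar>u x\<bar> \<le> 1" for \<kappa> and u :: "'a \<Rightarrow> real"
  proof -
    interpret prob_space \<kappa> using P k by blast
    note [measurable_cong] = P(2)[OF k]
    show ?thesis using u
      by (intro integrable_const_bound[where B=1]) (auto split: split_indicator)
  qed
  \<comment> \<open>Frequency zero isolates the constant term of the weights, which is then subtracted.\<close>
  have one: "(\<integral>x. indicat_real D x * 1 * indicator B (a \<bullet> x) \<partial>\<mu>) = (\<integral>x. indicat_real D x * 1 * indicator B (a \<bullet> x) \<partial>\<nu>)"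
    using w[of "\<lambda>x. sin (0 \<bullet> x)" 0] by simp
  have v: "(\<integral>x. indicator D x * u x * indicator B (a \<bullet> x) \<partial>\<mu>) = (\<integral>x. indicator D x * u x * indicator B (a \<bullet> x) \<partial>\<nu>)"
    if u: "u = (\<lambda>x. cos (t \<bullet> x)) \<or> u = (\<lambda>x. sin (t \<bullet> x))" for t and u :: "'a \<Rightarrow> real"
  proof -
    have um: "u \<in> borel_measurable borel" "\<And>x. \<bar>u x\<bar> \<le> 1" using u by auto
    have "(\<integral>x. (indicator D x * (1 + u x)) * indicator B (a \<bullet> x) \<partial>\<kappa>) =
       (\<integral>x. indicator D x * 1 * indicator B (a \<bullet> x) \<partial>\<kappa>) + (\<integral>x. indicator D x * u x * indicator B (a \<bullet> x) \<partial>\<kappa>)"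
      if k: "\<kappa> \<in> {\<mu>,\<nu>}" for \<kappa>
      by (subst Bochner_Integration.integral_add[symmetric])
         (use ib[OF k um] ib[OF k, of "\<lambda>_. 1"] in \<open>auto simp: algebra_simps\<close>)
    from this[of \<mu>] this[of \<nu>] w[OF u] one show ?thesis by simp
  qed
  have split: "(\<integral>x. indicator (D \<inter> {x. a \<bullet> x \<in> B}) x *\<^sub>R iexp (t \<bullet> x) \<partial>\<kappa>) =
     complex_of_real (\<integral>x. indicator D x * cos (t \<bullet> x) * indicator B (a \<bullet> x) \<partial>\<kappa>) +
     \<i> * complex_of_real (\<integral>x. indicator D x * sin (t \<bullet> x) * indicator B (a \<bullet> x) \<partial>\<kappa>)"
    if k: "\<kappa> \<in> {\<mu>,\<nu>}" for \<kappa>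
  proof -
    have "(\<integral>x. indicator (D \<inter> {x. a \<bullet> x \<in> B}) x *\<^sub>R iexp (t \<bullet> x) \<partial>\<kappa>) =
      (\<integral>x. complex_of_real (indicator D x * cos (t \<bullet> x) * indicator B (a \<bullet> x)) +
         \<i> * complex_of_real (indicator D x * sin (t \<bullet> x) * indicator B (a \<bullet> x)) \<partial>\<kappa>)"
      by (intro Bochner_Integration.integral_cong)
         (auto split: split_indicator simp: exp_Euler cos_of_real sin_of_real)
    also have "\<dots> = (\<integral>x. complex_of_real (indicator D x * cos (t \<bullet> x) * indicator B (a \<bullet> x)) \<partial>\<kappa>) +
         (\<integral>x. \<i> * complex_of_real (indicator D x * sin (t \<bullet> x) * indicator B (a \<bullet> x)) \<partial>\<kappa>)"
      by (intro Bochner_Integration.integral_add integrable_mult_right integrable_of_real ib[OF k]) auto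
    finally show ?thesis by (simp only: integral_mult_right_zero integral_complex_of_real)
  qed
  show ?thesis
    using split[of \<mu>] split[of \<nu>] v[of "\<lambda>x. cos (t \<bullet> x)" t] v[of "\<lambda>x. sin (t \<bullet> x)" t] by simp
qed

text \<open>
  A box is the intersection of finitely many slabs, one for each coordinate direction. Cutting with them one by one
  reaches every box, and frequency zero then compares the masses of boxes.
\<close>
theorem characteristic_function_unique:
  fixes \<mu> \<nu> :: "'a::euclidean_space measure"
  assumes \<mu>: "prob_space \<mu>" and \<nu>: "prob_space \<nu>" and s1: "sets \<mu> = sets borel" and s2: "sets \<nu> = sets borel"
    and eq: "\<And>t. (\<integral>x. iexp (t \<bullet> x) \<partial>\<mu>) = (\<integral>x. iexp (t \<bullet> x) \<partial>\<nu>)"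
  shows "\<mu> = \<nu>"
proof -
  interpret \<mu>: prob_space \<mu> by fact
  interpret \<nu>: prob_space \<nu> by fact
  note [measurable_cong] = s1 s2
  have slab: "{x. b \<bullet> x \<in> {l <..< r}} \<in> sets borel" for b :: 'a and l r :: real by measurable
  have main: "finite S \<Longrightarrow> (\<Inter>b\<in>S. {x. b \<bullet> x \<in> {l \<bullet> b <..< r \<bullet> b}}) \<in> sets borel \<and>
      (\<forall>t. (\<integral>x. indicator (\<Inter>b\<in>S. {x. b \<bullet> x \<in> {l \<bullet> b <..< r \<bullet> b}}) x *\<^sub>R iexp (t \<bullet> x) \<partial>\<mu>)
       = (\<integral>x. indicator (\<Inter>b\<in>S. {x. b \<bullet> x \<in> {l \<bullet> b <..< r \<bullet> b}}) x *\<^sub>R iexp (t \<bullet> x) \<partial>\<nu>))"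
    for S :: "'a set" and l r :: 'a
  proof (induction S rule: finite_induct)
    case empty
    then show ?case using eq by simp
  next
    case (insert a S)
    let ?D = "\<Inter>b\<in>S. {x. b \<bullet> x \<in> {l \<bullet> b <..< r \<bullet> b}}"
    have e: "(\<Inter>b\<in>insert a S. {x. b \<bullet> x \<in> {l \<bullet> b <..< r \<bullet> b}}) = ?D \<inter> {x. a \<bullet> x \<in> {l \<bullet> a <..< r \<bullet> a}}"
      by auto
    have IH: "?D \<in> sets borel" "\<And>t. (\<integral>x. indicator ?D x *\<^sub>R iexp (t \<bullet> x) \<partial>\<mu>) = (\<integral>x. indicator ?D x *\<^sub>R iexp (t \<bullet> x) \<partial>\<nu>)"
      using insert.IH by blast+
    show ?case unfolding e
      using sets.Int[OF IH(1) slab[of a "l \<bullet> a" "r \<bullet> a"]]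
        char_equality_restrict[OF \<mu> \<nu> s1 s2 IH, of "{l \<bullet> a <..< r \<bullet> a}" a]
        greaterThanLessThan_borel
      by blast
  qed
  have box: "emeasure \<mu> (box l r) = emeasure \<nu> (box l r)" for l r
  proof -
    have b: "box l r = (\<Inter>b\<in>Basis. {x. b \<bullet> x \<in> {l \<bullet> b <..< r \<bullet> b}})"
      by (auto simp: box_def inner_commute)
    have "(\<integral>x. indicator (box l r) x *\<^sub>R iexp (0 \<bullet> x) \<partial>\<mu>) = (\<integral>x. indicator (box l r) x *\<^sub>R iexp (0 \<bullet> x) \<partial>\<nu>)"
      using main[OF finite_Basis, of l r] unfolding b by blast
    then have "complex_of_real (measure \<mu> (box l r)) = complex_of_real (measure \<nu> (box l r))"
      by (simp add: scaleR_conv_of_real)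
    then show ?thesis by (simp add: \<mu>.emeasure_eq_measure \<nu>.emeasure_eq_measure)
  qed
  let ?E = "range (\<lambda>(a, b). box a b :: 'a set)"
  have U: "(\<Union>n. box (- (real n *\<^sub>R One)) (real n *\<^sub>R One :: 'a)) = UNIV" by (rule UN_box_eq_UNIV)
  show ?thesis
  proof (rule measure_eqI_generator_eq[where \<Omega>=UNIV and E="?E" and A="\<lambda>n. box (- (real n *\<^sub>R One)) (real n *\<^sub>R One :: 'a)"])
    show "Int_stable ?E" unfolding Int_stable_def by (auto simp: box_Int_box)
    show "sets \<mu> = sigma_sets UNIV ?E" "sets \<nu> = sigma_sets UNIV ?E"
      using s1 s2 by (simp_all add: borel_eq_box)
  qed (use box U in auto)
qed

section \<open>Rotation invariance of matrices with independent Gaussian rows\<close>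

text \<open>
  The variance is expressed as the second moment \<open>\<integral> (a \<bullet> x)\<^sup>2\<close> instead of the \<open>\<sigma>\<close> of the definition,
  because sums of such integrals over rows can be compared under an integral sign.
\<close>
lemma centered_gaussian_projection:
  fixes \<gamma> :: "'a::euclidean_space measure"
  assumes "centered_gaussian \<gamma>"
  shows integrable_square_centered_gaussian: "integrable \<gamma> (\<lambda>x. (a \<bullet> x)\<^sup>2)"
    and char_centered_gaussian: "(\<integral>x. iexp (a \<bullet> x) \<partial>\<gamma>) = complex_of_real (exp (- (\<integral>x. (a \<bullet> x)\<^sup>2 \<partial>\<gamma>) / 2))"
proof -
  have s[measurable_cong]: "sets \<gamma> = sets borel" using assms by (simp add: centered_gaussian_def)
  obtain \<sigma> where \<sigma>: "distr \<gamma> borel (\<lambda>x. a \<bullet> x) = distr std_normal_distribution borel (\<lambda>x. \<sigma> * x)"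
    using assms unfolding centered_gaussian_def by blast
  have [measurable]: "(\<lambda>x. a \<bullet> x) \<in> borel_measurable \<gamma>" by measurable
  have i: "integrable std_normal_distribution (\<lambda>x. (\<sigma> * x)\<^sup>2)"
    using integrable_std_normal_distribution_moment[of 2] by (simp add: power_mult_distrib)
  have "integrable (distr \<gamma> borel (\<lambda>x. a \<bullet> x)) (\<lambda>x. x\<^sup>2)"
    unfolding \<sigma> by (subst integrable_distr_eq) (use i in auto)
  then show "integrable \<gamma> (\<lambda>x. (a \<bullet> x)\<^sup>2)"
    by (subst (asm) integrable_distr_eq) auto
  have "(\<integral>x. (a \<bullet> x)\<^sup>2 \<partial>\<gamma>) = (\<integral>x. x\<^sup>2 \<partial>distr \<gamma> borel (\<lambda>x. a \<bullet> x))"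
    by (subst integral_distr) auto
  also have "\<dots> = (\<integral>x. (\<sigma> * x)\<^sup>2 \<partial>std_normal_distribution)"
    unfolding \<sigma> by (subst integral_distr) auto
  also have "\<dots> = \<sigma>\<^sup>2"
    using std_normal_distribution_even_moments(1)[of 1] by (simp add: power_mult_distrib)
  finally have v: "(\<integral>x. (a \<bullet> x)\<^sup>2 \<partial>\<gamma>) = \<sigma>\<^sup>2" .
  have "(\<integral>x. iexp (a \<bullet> x) \<partial>\<gamma>) = (\<integral>x. iexp x \<partial>distr \<gamma> borel (\<lambda>x. a \<bullet> x))"
    by (subst integral_distr) auto
  also have "\<dots> = (\<integral>x. iexp (\<sigma> * x) \<partial>std_normal_distribution)"
    unfolding \<sigma> by (subst integral_distr) auto
  also have "\<dots> = complex_of_real (exp (- (\<sigma>\<^sup>2) / 2))"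
    using char_std_normal_distribution unfolding char_def by meson
  finally show "(\<integral>x. iexp (a \<bullet> x) \<partial>\<gamma>) = complex_of_real (exp (- (\<integral>x. (a \<bullet> x)\<^sup>2 \<partial>\<gamma>) / 2))"
    by (simp add: v)
qed

lemma borel_measurable_matrix_mult:
  fixes A :: "real^'m^'n" 
  shows "(\<lambda>w::real^'k^'m. A ** w) \<in> borel_measurable borel"
  unfolding matrix_matrix_mult_def
  by (intro borel_measurable_continuous_onI continuous_intros)

context prob_space
begin

text \<open>
  The rows \<open>T\<^sub>i\<close> of the frequency matrix contribute the factors \<open>exp (- \<integral> (T\<^sub>i \<bullet> x)\<^sup>2 / 2)\<close>, and the sum of
  the squares \<open>(T\<^sub>i \<bullet> x)\<^sup>2\<close> is the squared norm of \<open>T x\<close>. In this form the dependence on \<open>T\<close>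
  is visibly unchanged when \<open>T\<close> is multiplied from the left by an orthogonal matrix.
\<close>
lemma char_gaussian_rows:
  fixes W :: "'a \<Rightarrow> real^'k^'m"
  assumes W[measurable]: "W \<in> borel_measurable M" and ind: "indep_vars (\<lambda>_. borel) (\<lambda>i \<omega>. W \<omega> $ i) UNIV"
    and \<gamma>: "centered_gaussian \<gamma>" and law: "\<And>i. distr M borel (\<lambda>\<omega>. W \<omega> $ i) = \<gamma>"
  shows "(\<integral>\<omega>. iexp (T \<bullet> W \<omega>) \<partial>M) = complex_of_real (exp (- (\<integral>x. (norm (T *v x))\<^sup>2 \<partial>\<gamma>) / 2))"
proof -
  have [measurable]: "(\<lambda>\<omega>. W \<omega> $ i) \<in> borel_measurable M" for i
    by (rule measurable_compose[OF W borel_measurable_continuous_onI]) (intro continuous_intros)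
  have row: "(\<integral>\<omega>. iexp (T $ i \<bullet> W \<omega> $ i) \<partial>M) = complex_of_real (exp (- (\<integral>x. (T $ i \<bullet> x)\<^sup>2 \<partial>\<gamma>) / 2))" for i
    unfolding char_centered_gaussian[OF \<gamma>, symmetric] by (subst law[of i, symmetric], subst integral_distr) auto
  have "(\<integral>\<omega>. iexp (T \<bullet> W \<omega>) \<partial>M) = (\<integral>\<omega>. (\<Prod>i\<in>UNIV. iexp (T $ i \<bullet> W \<omega> $ i)) \<partial>M)"
    by (simp add: inner_vec_def[of T] exp_sum sum_distrib_left)
  also have "\<dots> = (\<Prod>i\<in>UNIV. \<integral>\<omega>. iexp (T $ i \<bullet> W \<omega> $ i) \<partial>M)"
  proof (rule indep_vars_lebesgue_integral)
    show "indep_vars (\<lambda>_. borel) (\<lambda>i \<omega>. iexp (T $ i \<bullet> W \<omega> $ i)) UNIV"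
      by (rule indep_vars_compose2[OF ind]) measurable
    show "integrable M (\<lambda>\<omega>. iexp (T $ i \<bullet> W \<omega> $ i))" for i
      by (rule integrable_const_bound[where B=1]) auto
  qed auto
  also have "\<dots> = (\<Prod>i\<in>UNIV. complex_of_real (exp (- (\<integral>x. (T $ i \<bullet> x)\<^sup>2 \<partial>\<gamma>) / 2)))"
    by (simp only: row)
  also have "(\<Prod>i\<in>UNIV. complex_of_real (exp (- (\<integral>x. (T $ i \<bullet> x)\<^sup>2 \<partial>\<gamma>) / 2)))
     = complex_of_real (exp (- (\<Sum>i\<in>UNIV. \<integral>x. (T $ i \<bullet> x)\<^sup>2 \<partial>\<gamma>) / 2))"
    by (simp add: exp_sum[symmetric] sum_negf sum_divide_distrib flip: of_real_prod)
  also have "(\<Sum>i\<in>UNIV. \<integral>x. (T $ i \<bullet> x)\<^sup>2 \<partial>\<gamma>) = (\<integral>x. (\<Sum>i\<in>UNIV. (T $ i \<bullet> x)\<^sup>2) \<partial>\<gamma>)"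
    by (intro Bochner_Integration.integral_sum[symmetric] integrable_square_centered_gaussian \<gamma>)
  also have "(\<lambda>x. (\<Sum>i\<in>UNIV. (T $ i \<bullet> x)\<^sup>2)) = (\<lambda>x. (norm (T *v x))\<^sup>2)"
    unfolding power2_norm_eq_inner
    by (simp add: inner_vec_def matrix_vector_mult_def power2_eq_square)
  finally show ?thesis .
qed

text \<open>
  Moving \<open>A\<close> to the frequency side turns \<open>T\<close> into its product with the transpose of \<open>A\<close>, and the
  characteristic function sees only the norm of \<open>T x\<close>, which the transpose of \<open>A\<close> preserves.
\<close>
lemma gaussian_rows_rotation_invariant:
  fixes W :: "'a \<Rightarrow> real^'k^'m"
  assumes W[measurable]: "W \<in> borel_measurable M" and ind: "indep_vars (\<lambda>_. borel) (\<lambda>i \<omega>. W \<omega> $ i) UNIV"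
    and \<gamma>: "centered_gaussian \<gamma>" and law: "\<And>i. distr M borel (\<lambda>\<omega>. W \<omega> $ i) = \<gamma>"
    and A: "orthogonal_matrix (A :: real^'m^'m)"
  shows "distr M borel (\<lambda>\<omega>. A ** W \<omega>) = distr M borel W"
proof (rule characteristic_function_unique)
  have [measurable]: "(\<lambda>\<omega>. A ** W \<omega>) \<in> borel_measurable M"
    by (rule measurable_compose[OF W borel_measurable_matrix_mult])
  show "prob_space (distr M borel (\<lambda>\<omega>. A ** W \<omega>))" "prob_space (distr M borel W)"
    by (auto intro: prob_space_distr)
  fix T :: "real^'k^'m"
  have adj: "T \<bullet> (A ** w) = (transpose A ** T) \<bullet> w" for w :: "real^'k^'m"
  proof -
    have "T \<bullet> (A ** w) = (\<Sum>i\<in>UNIV. \<Sum>j\<in>UNIV. \<Sum>l\<in>UNIV. T$i$j * (A$i$l * w$l$j))"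
      by (simp add: inner_vec_def matrix_matrix_mult_def sum_distrib_left)
    also have "\<dots> = (\<Sum>l\<in>UNIV. \<Sum>j\<in>UNIV. \<Sum>i\<in>UNIV. T$i$j * (A$i$l * w$l$j))"
      by (subst sum.swap, subst (2) sum.swap, subst sum.swap) rule
    also have "\<dots> = (transpose A ** T) \<bullet> w"
      by (simp add: inner_vec_def matrix_matrix_mult_def transpose_def sum_distrib_right sum_distrib_left mult_ac)
    finally show ?thesis .
  qed
  have "orthogonal_matrix (transpose A)" using A by simp
  then have "orthogonal_transformation ((*v) (transpose A))"
    by (simp add: orthogonal_transformation_matrix)
  then have n: "norm (transpose A *v y) = norm y" for y
    by (rule orthogonal_transformation_norm)
  have "(\<integral>x. iexp (T \<bullet> x) \<partial>distr M borel (\<lambda>\<omega>. A ** W \<omega>)) = (\<integral>\<omega>. iexp ((transpose A ** T) \<bullet> W \<omega>) \<partial>M)"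
    by (subst integral_distr) (auto simp: adj)
  also have "\<dots> = (\<integral>\<omega>. iexp (T \<bullet> W \<omega>) \<partial>M)"
    by (subst (1 2) char_gaussian_rows[OF W ind \<gamma> law]) (simp only: matrix_vector_mul_assoc[symmetric] n)
  also have "\<dots> = (\<integral>x. iexp (T \<bullet> x) \<partial>distr M borel W)"
    by (subst integral_distr) auto
  finally show "(\<integral>x. iexp (T \<bullet> x) \<partial>distr M borel (\<lambda>\<omega>. A ** W \<omega>)) = (\<integral>x. iexp (T \<bullet> x) \<partial>distr M borel W)" .
qed auto

end

section \<open>Joint law of the chi-square risk\<close>

lemma distr_pair_indep_vectors:
  assumes "prob_space M" and Y[measurable]: "Y \<in> borel_measurable M" and Z[measurable]: "Z \<in> borel_measurable M"
    and ind: "indep_vectors M Y Z"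
  shows "distr M (borel \<Otimes>\<^sub>M borel) (\<lambda>\<omega>. (Y \<omega>, Z \<omega>)) = distr M borel Y \<Otimes>\<^sub>M distr M borel Z"
proof -
  interpret prob_space M by fact
  interpret Y: prob_space "distr M borel Y" by (rule prob_space_distr) simp
  interpret Z: prob_space "distr M borel Z" by (rule prob_space_distr) simp
  show ?thesis
  proof (rule pair_measure_eqI[symmetric])
    show "sigma_finite_measure (distr M borel Y)" "sigma_finite_measure (distr M borel Z)"
      by unfold_locales
    fix A B assume "A \<in> sets (distr M borel Y)" "B \<in> sets (distr M borel Z)"
    then have [measurable]: "A \<in> sets borel" "B \<in> sets borel" by auto
    have "prob ((Y -` A \<inter> space M) \<inter> (Z -` B \<inter> space M)) = prob (Y -` A \<inter> space M) * prob (Z -` B \<inter> space M)"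
      by (rule indep_setD[OF ind[unfolded indep_vectors_def]]) auto
    moreover have "(Y -` A \<inter> space M) \<inter> (Z -` B \<inter> space M) = (\<lambda>\<omega>. (Y \<omega>, Z \<omega>)) -` (A \<times> B) \<inter> space M"
      by auto
    ultimately show "emeasure (distr M borel Y) A * emeasure (distr M borel Z) B =
        emeasure (distr M (borel \<Otimes>\<^sub>M borel) (\<lambda>\<omega>. (Y \<omega>, Z \<omega>))) (A \<times> B)"
      by (simp add: emeasure_distr emeasure_eq_measure ennreal_mult'')
  qed simp
qed

text \<open>
  The sums of squares in positions \<open>2, \<dots>, k + 1\<close>, given first column \<open>r\<close> and noise \<open>w\<close>.
\<close>
definition perturbed_tail :: "real^'k \<Rightarrow> real^'m::finite \<Rightarrow> real^'k^'m \<Rightarrow> real^'k::finite" where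
  "perturbed_tail \<rho> r w = (\<chi> j. \<Sum>i\<in>UNIV. (\<rho> $ j * r $ i + w $ i $ j)\<^sup>2)"

text \<open>
  For \<open>z \<ge> 0\<close> this is \<open>perturbed_tail\<close> at the column \<open>r\<close> whose only nonzero entry is \<open>sqrt z\<close> in row \<open>i0\<close>.
\<close>
definition radial_tail :: "'m::finite \<Rightarrow> real^'k \<Rightarrow> real \<Rightarrow> real^'k^'m \<Rightarrow> real^'k::finite" where
  "radial_tail i0 \<rho> z w =
     (\<chi> j. (\<rho> $ j)\<^sup>2 * z + 2 * \<rho> $ j * sqrt z * w $ i0 $ j + (\<Sum>i\<in>UNIV. (w $ i $ j)\<^sup>2))"

lemma perturbed_tail_measurable[measurable]:
  "case_prod (perturbed_tail \<rho>) \<in> borel \<Otimes>\<^sub>M borel \<rightarrow>\<^sub>M borel"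
  unfolding borel_prod perturbed_tail_def split_beta
  by (intro borel_measurable_continuous_onI continuous_intros)

lemma radial_tail_measurable[measurable]:
  "case_prod (radial_tail i0 \<rho>) \<in> borel \<Otimes>\<^sub>M borel \<rightarrow>\<^sub>M borel"
  unfolding borel_prod radial_tail_def split_beta
  by (intro borel_measurable_continuous_onI continuous_intros)

lemma radial_tail_slice_measurable[measurable]: "radial_tail i0 \<rho> v \<in> borel_measurable borel"
  using measurable_compose[OF measurable_Pair1' radial_tail_measurable[of i0 \<rho>], of v] by simp

lemma norm_squared_eq_sum: "(norm (x :: real^'n))\<^sup>2 = (\<Sum>i\<in>UNIV. (x $ i)\<^sup>2)"
  unfolding power2_norm_eq_inner by (simp add: inner_vec_def power2_eq_square)

text \<open>
  An orthogonal \<open>A\<close> that moves \<open>r\<close> to a multiple of a coordinate vector can be applied to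
  \<open>\<rho>\<^sub>j r\<close> plus the \<open>j\<close>-th column of \<open>w\<close> without changing its norm, for all \<open>j\<close> at once.
\<close>
lemma perturbed_tail_rotate:
  fixes r :: "real^'m" and \<rho> :: "real^'k" and i0 :: 'm
  obtains A :: "real^'m^'m" where "orthogonal_matrix A"
    and "\<And>w. perturbed_tail \<rho> r w = radial_tail i0 \<rho> ((norm r)\<^sup>2) (A ** w)"
proof -
  have "norm r = norm (norm r *\<^sub>R axis i0 (1::real) :: real^'m)" by simp
  then obtain f :: "real^'m \<Rightarrow> real^'m" where f: "orthogonal_transformation f" "f r = norm r *\<^sub>R axis i0 1"
    by (rule orthogonal_transformation_exists) blast
  define A where "A = matrix f"
  have Av: "A *v x = f x" for x
    using f(1) by (simp add: A_def orthogonal_transformation_def matrix_works)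
  have A: "orthogonal_matrix A" using f(1) by (simp add: A_def orthogonal_transformation_matrix)
  have "perturbed_tail \<rho> r w = radial_tail i0 \<rho> ((norm r)\<^sup>2) (A ** w)" for w
  proof -
    have "(\<Sum>i\<in>UNIV. (\<rho> $ j * r $ i + w $ i $ j)\<^sup>2) =
       (\<rho> $ j)\<^sup>2 * (norm r)\<^sup>2 + 2 * \<rho> $ j * norm r * (A ** w) $ i0 $ j + (\<Sum>i\<in>UNIV. ((A ** w) $ i $ j)\<^sup>2)" for j
    proof -
      have col: "A *v column j w = column j (A ** w)"
        by (simp add: vec_eq_iff column_def matrix_vector_mult_def matrix_matrix_mult_def)
      have "(\<Sum>i\<in>UNIV. (\<rho> $ j * r $ i + w $ i $ j)\<^sup>2) = (norm (\<rho> $ j *\<^sub>R r + column j w))\<^sup>2"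
        by (simp add: norm_squared_eq_sum column_def)
      also have "\<dots> = (norm (A *v (\<rho> $ j *\<^sub>R r + column j w)))\<^sup>2"
        using orthogonal_transformation_norm[OF f(1)] by (simp add: Av)
      also have "A *v (\<rho> $ j *\<^sub>R r + column j w) = (\<rho> $ j * norm r) *\<^sub>R axis i0 1 + column j (A ** w)"
        by (simp add: matrix_vector_right_distrib matrix_vector_mult_scaleR Av[of r] f(2) col)
      also have "(norm \<dots>)\<^sup>2 = (\<rho> $ j * norm r)\<^sup>2 + 2 * (\<rho> $ j * norm r * column j (A ** w) $ i0) + (norm (column j (A ** w)))\<^sup>2"
        unfolding power2_norm_eq_inner
        by (simp add: inner_add_left inner_add_right inner_axis inner_axis' inner_commute power2_eq_square
             axis_nth)
      finally show ?thesis 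
        unfolding norm_squared_eq_sum[of "column j (A ** w)"] by (simp add: column_def power_mult_distrib)
    qed
    then show ?thesis by (simp add: perturbed_tail_def radial_tail_def vec_eq_iff)
  qed
  with A show thesis by (rule that)
qed

lemma vec_tl_continuous: "continuous_on UNIV (vec_tl :: real^('k::finite option) \<Rightarrow> real^'k)"
  unfolding vec_tl_def by (intro continuous_intros)

lemma chi_square_risk_continuous: "continuous_on UNIV (chi_square_risk id :: real^('k::finite option)^'m::finite \<Rightarrow> real^('k option))"
  unfolding chi_square_risk_def by (intro continuous_intros)

lemma borel_measurable_chi_square_risk:
  fixes X :: "'w \<Rightarrow> real^('k::finite option)^'m::finite"
  assumes X[measurable]: "X \<in> borel_measurable M"
  shows "chi_square_risk X \<in> borel_measurable M"
proof -
  have "(\<lambda>\<omega>. chi_square_risk id (X \<omega>)) \<in> borel_measurable M"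
    by (rule measurable_compose[OF X borel_measurable_continuous_onI[OF chi_square_risk_continuous]])
  then show ?thesis by (simp add: chi_square_risk_def[abs_def])
qed

text \<open>
  The law of \<open>r\<close> is arbitrary, so nothing is known about its direction; but given \<open>r\<close>, rotating the
  Gaussian noise shows that the other coordinates depend on \<open>r\<close> in law only through its norm.
\<close>
lemma joint_law_radial:
  fixes X :: "'w \<Rightarrow> real^('k::finite option)^'m::finite" and i0 :: 'm
  assumes risk: "perturbed_representation M \<rho> X W" and A: "assumption_A M \<gamma> X W"
  defines "Z \<equiv> \<lambda>\<omega>. chi_square_risk X \<omega> $ None"
  shows "distr M (borel \<Otimes>\<^sub>M borel) (\<lambda>\<omega>. (Z \<omega>, vec_tl (chi_square_risk X \<omega>))) =
    distr (distr M borel Z \<Otimes>\<^sub>M distr M borel W) (borel \<Otimes>\<^sub>M borel) (\<lambda>(z, w). (z, radial_tail i0 \<rho> z w))"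
proof -
  interpret prob_space M using risk by (simp add: perturbed_representation_def)
  have X[measurable]: "X \<in> borel_measurable M" and W[measurable]: "W \<in> borel_measurable M"
    and law: "distr M borel X = distr M borel (\<lambda>\<omega>. \<chi> i. vec_cons (X \<omega> $ i $ None)
                                     (\<chi> j. \<rho> $ j * X \<omega> $ i $ None + W \<omega> $ i $ j))"
    using risk by (auto simp: perturbed_representation_def)
  have rows: "indep_vars (\<lambda>_. borel) (\<lambda>i \<omega>. W \<omega> $ i) UNIV" "centered_gaussian \<gamma>" "\<And>i. distr M borel (\<lambda>\<omega>. W \<omega> $ i) = \<gamma>"
    using A by (auto simp: assumption_A_def)
  define R where "R = (\<lambda>\<omega>. \<chi> i. X \<omega> $ i $ None)"
  have R[measurable]: "R \<in> borel_measurable M"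
    unfolding R_def by (rule measurable_compose[OF X borel_measurable_continuous_onI]) (intro continuous_intros)
  have indRW: "distr M (borel \<Otimes>\<^sub>M borel) (\<lambda>\<omega>. (R \<omega>, W \<omega>)) = distr M borel R \<Otimes>\<^sub>M distr M borel W"
    using A[unfolded assumption_A_def, folded R_def] by (intro distr_pair_indep_vectors) (auto simp: prob_space_axioms)
  have ZR: "Z = (\<lambda>\<omega>. (norm (R \<omega>))\<^sup>2)"
    unfolding power2_norm_eq_inner by (auto simp: Z_def R_def chi_square_risk_def inner_vec_def power2_eq_square)
  interpret PW: prob_space "distr M borel W" by (rule prob_space_distr) simp
  let ?X' = "\<lambda>\<omega>. \<chi> i. vec_cons (X \<omega> $ i $ None) (\<chi> j. \<rho> $ j * X \<omega> $ i $ None + W \<omega> $ i $ j)"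
  have X'[measurable]: "?X' \<in> borel_measurable M"
  proof -
    have "continuous_on UNIV (\<lambda>p::(real^'m) \<times> (real^'k^'m). \<chi> i. vec_cons (fst p $ i) (\<chi> j. \<rho> $ j * fst p $ i + snd p $ i $ j))"
      unfolding vec_cons_def
    proof (intro continuous_intros)
      fix i and o' :: "'k option"
      show "continuous_on UNIV (\<lambda>p::(real^'m) \<times> (real^'k^'m). case o' of None \<Rightarrow> fst p $ i
              | Some l \<Rightarrow> (\<chi> j. \<rho> $ j * fst p $ i + snd p $ i $ j) $ l)"
        by (cases o') (auto intro!: continuous_intros)
    qed
    then have "(\<lambda>p::(real^'m) \<times> (real^'k^'m). \<chi> i. vec_cons (fst p $ i) (\<chi> j. \<rho> $ j * fst p $ i + snd p $ i $ j)) \<in> borel \<Otimes>\<^sub>M borel \<rightarrow>\<^sub>M borel"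
      unfolding borel_prod by (rule borel_measurable_continuous_onI)
    from measurable_compose[OF _ this, of "\<lambda>\<omega>. (R \<omega>, W \<omega>)" M]
    show ?thesis by (simp add: R_def[symmetric]) (simp add: R_def)
  qed
  define G :: "real^('k option)^'m \<Rightarrow> real \<times> (real^'k)"
    where "G x = (chi_square_risk id x $ None, vec_tl (chi_square_risk id x))" for x
  have "continuous_on UNIV G"
    unfolding G_def by (intro continuous_intros chi_square_risk_continuous continuous_on_compose2[OF vec_tl_continuous]) auto
  then have G[measurable]: "G \<in> borel \<rightarrow>\<^sub>M borel \<Otimes>\<^sub>M borel"
    unfolding borel_prod by (rule borel_measurable_continuous_onI)
  have "distr M (borel \<Otimes>\<^sub>M borel) (\<lambda>\<omega>. (Z \<omega>, vec_tl (chi_square_risk X \<omega>))) = distr (distr M borel X) (borel \<Otimes>\<^sub>M borel) G"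
    by (subst distr_distr) (auto simp: comp_def G_def Z_def chi_square_risk_def)
  also have "\<dots> = distr M (borel \<Otimes>\<^sub>M borel) (\<lambda>\<omega>. G (?X' \<omega>))"
    unfolding law by (subst distr_distr) (auto simp: comp_def)
  also have "(\<lambda>\<omega>. G (?X' \<omega>)) = (\<lambda>\<omega>. (case (R \<omega>, W \<omega>) of (r, w) \<Rightarrow> ((norm r)\<^sup>2, perturbed_tail \<rho> r w)))"
    by (rule ext) (simp add: G_def chi_square_risk_def vec_tl_def perturbed_tail_def vec_cons_def R_def
        norm_squared_eq_sum)
  also have "distr M (borel \<Otimes>\<^sub>M borel) \<dots> =
     distr (distr M borel R \<Otimes>\<^sub>M distr M borel W) (borel \<Otimes>\<^sub>M borel) (\<lambda>(r, w). ((norm r)\<^sup>2, perturbed_tail \<rho> r w))"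
    unfolding indRW[symmetric] by (subst distr_distr) (auto simp: comp_def)
  also have "\<dots> = distr (distr M borel Z \<Otimes>\<^sub>M distr M borel W) (borel \<Otimes>\<^sub>M borel) (\<lambda>(z, w). (z, radial_tail i0 \<rho> z w))"
  proof (rule measure_eqI)
    fix C assume "C \<in> sets (distr (distr M borel R \<Otimes>\<^sub>M distr M borel W) (borel \<Otimes>\<^sub>M borel) (\<lambda>(r, w). ((norm r)\<^sup>2, perturbed_tail \<rho> r w)))"
    then have [measurable]: "C \<in> sets (borel \<Otimes>\<^sub>M borel)" by simp
    \<comment> \<open>The rotation depends on \<open>r\<close>, so invariance of the noise is used with \<open>r\<close> held fixed.\<close>
    have slice: "(\<integral>\<^sup>+w. indicator C (z, perturbed_tail \<rho> r w) \<partial>distr M borel W) =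
        (\<integral>\<^sup>+w. indicator C (z, radial_tail i0 \<rho> z w) \<partial>distr M borel W)" if z: "z = (norm r)\<^sup>2" for r z
    proof -
      obtain A :: "real^'m^'m" where A: "orthogonal_matrix A"
        and eq: "\<And>w. perturbed_tail \<rho> r w = radial_tail i0 \<rho> ((norm r)\<^sup>2) (A ** w)"
        by (rule perturbed_tail_rotate[of \<rho> r i0]) blast
      have [measurable]: "(\<lambda>\<omega>. A ** W \<omega>) \<in> borel_measurable M"
        by (rule measurable_compose[OF W borel_measurable_matrix_mult])
      note borel_measurable_matrix_mult[of A, measurable]
      have "(\<integral>\<^sup>+w. indicator C (z, perturbed_tail \<rho> r w) \<partial>distr M borel W) =
         (\<integral>\<^sup>+w. indicator C (z, radial_tail i0 \<rho> z w) \<partial>distr M borel (\<lambda>\<omega>. A ** W \<omega>))"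
        by (subst (1 2) nn_integral_distr) (auto simp: eq z)
      then show ?thesis
        by (simp add: gaussian_rows_rotation_invariant[OF W rows A])
    qed
    have "emeasure (distr (distr M borel R \<Otimes>\<^sub>M distr M borel W) (borel \<Otimes>\<^sub>M borel) (\<lambda>(r, w). ((norm r)\<^sup>2, perturbed_tail \<rho> r w))) C
       = (\<integral>\<^sup>+p. indicator C p \<partial>distr (distr M borel R \<Otimes>\<^sub>M distr M borel W) (borel \<Otimes>\<^sub>M borel) (\<lambda>(r, w). ((norm r)\<^sup>2, perturbed_tail \<rho> r w)))"
      by simp
    also have "\<dots> = (\<integral>\<^sup>+p. indicator C ((norm (fst p))\<^sup>2, perturbed_tail \<rho> (fst p) (snd p)) \<partial>(distr M borel R \<Otimes>\<^sub>M distr M borel W))"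
      by (subst nn_integral_distr) (auto simp: split_beta)
    also have "\<dots> = (\<integral>\<^sup>+r. \<integral>\<^sup>+w. indicator C ((norm r)\<^sup>2, perturbed_tail \<rho> r w) \<partial>distr M borel W \<partial>distr M borel R)"
      by (subst PW.nn_integral_fst[symmetric]) auto
    also have "\<dots> = (\<integral>\<^sup>+r. \<integral>\<^sup>+w. indicator C ((norm r)\<^sup>2, radial_tail i0 \<rho> ((norm r)\<^sup>2) w) \<partial>distr M borel W \<partial>distr M borel R)"
      by (simp add: slice)
    also have "\<dots> = (\<integral>\<^sup>+z. \<integral>\<^sup>+w. indicator C (z, radial_tail i0 \<rho> z w) \<partial>distr M borel W \<partial>distr M borel Z)"
      unfolding ZR by (subst (1 2) nn_integral_distr) auto
    also have "\<dots> = (\<integral>\<^sup>+p. indicator C (fst p, radial_tail i0 \<rho> (fst p) (snd p)) \<partial>(distr M borel Z \<Otimes>\<^sub>M distr M borel W))"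
      by (subst PW.nn_integral_fst[symmetric]) auto
    also have "\<dots> = (\<integral>\<^sup>+p. indicator C p \<partial>distr (distr M borel Z \<Otimes>\<^sub>M distr M borel W) (borel \<Otimes>\<^sub>M borel) (\<lambda>(z, w). (z, radial_tail i0 \<rho> z w)))"
      by (subst nn_integral_distr) (auto simp: split_beta)
    also have "\<dots> = emeasure (distr (distr M borel Z \<Otimes>\<^sub>M distr M borel W) (borel \<Otimes>\<^sub>M borel) (\<lambda>(z, w). (z, radial_tail i0 \<rho> z w))) C"
      by simp
    finally show "emeasure (distr (distr M borel R \<Otimes>\<^sub>M distr M borel W) (borel \<Otimes>\<^sub>M borel) (\<lambda>(r, w). ((norm r)\<^sup>2, perturbed_tail \<rho> r w))) C = \<dots>" .
  qed simp
  finally show ?thesis .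
qed

section \<open>Conditioning and weak convergence\<close>

text \<open>
  Countability lets exceptional null sets be united; stability under intersection makes measures
  that agree on the generator equal.
\<close>
lemma ex_countable_Int_stable_generator:
  obtains \<B> :: "'a::second_countable_topology set set"
  where "countable \<B>" "Int_stable \<B>" "UNIV \<in> \<B>" "borel = sigma UNIV \<B>"
proof -
  obtain B :: "'a set set" where B: "countable B" "topological_basis B"
    using ex_countable_basis by blast
  define \<B> where "\<B> = Inter ` {b. finite b \<and> b \<subseteq> B}"
  have c: "countable \<B>" unfolding \<B>_def using B(1)
    by (intro countable_image countable_Collect_finite_subset)
  have BB: "B \<subseteq> \<B>"
  proof
    fix x assume "x \<in> B"
    then have "\<Inter>{x} \<in> \<B>" unfolding \<B>_def by (intro imageI) auto
    then show "x \<in> \<B>" by simp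
  qed
  have "topological_basis \<B>"
    unfolding topological_basis_def
  proof (intro conjI ballI allI impI)
    fix x assume "x \<in> \<B>"
    then show "open x" unfolding \<B>_def using topological_basis_open[OF B(2)] by (auto intro!: open_Inter)
  next
    fix x :: "'a set" assume "open x"
    then show "\<exists>B'\<subseteq>\<B>. \<Union> B' = x" using B(2) BB unfolding topological_basis_def by (meson subset_trans)
  qed
  then have "borel = sigma UNIV \<B>" by (rule borel_eq_countable_basis[OF c])
  moreover have "Int_stable \<B>"
  proof (rule Int_stableI)
    fix a b assume "a \<in> \<B>" "b \<in> \<B>"
    then obtain s t where "finite s" "s \<subseteq> B" "a = \<Inter>s" "finite t" "t \<subseteq> B" "b = \<Inter>t" unfolding \<B>_def by auto
    then have "a \<inter> b = \<Inter>(s \<union> t)" "finite (s \<union> t)" "s \<union> t \<subseteq> B" by auto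
    then show "a \<inter> b \<in> \<B>" unfolding \<B>_def by blast
  qed
  moreover have "UNIV \<in> \<B>" unfolding \<B>_def by (rule image_eqI[of _ _ "{}"]) auto
  ultimately show ?thesis using c that by blast
qed

text \<open>
  For each Borel set, both kernels are densities of the same measure, hence equal almost everywhere;
  countably many sets suffice to identify the measures.
\<close>
lemma regular_cond_distr_unique:
  fixes Y :: "'w \<Rightarrow> 'b::second_countable_topology"
  assumes "prob_space M" and Z[measurable]: "Z \<in> borel_measurable M"
    and k1: "regular_cond_distr M Z Y \<kappa>" and k2: "regular_cond_distr M Z Y \<kappa>'"
  obtains S where "S \<in> null_sets (distr M borel Z)" "\<And>v. v \<notin> S \<Longrightarrow> \<kappa> v = \<kappa>' v"
proof -
  interpret prob_space M by fact
  interpret P: prob_space "distr M borel Z" by (rule prob_space_distr) simp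
  obtain \<B> :: "'b set set" where \<B>: "countable \<B>" "Int_stable \<B>" "UNIV \<in> \<B>" "borel = sigma UNIV \<B>"
    by (rule ex_countable_Int_stable_generator)
  have sB: "sets (borel :: 'b measure) = sigma_sets UNIV \<B>"
    by (subst \<B>(4)) (rule sets_measure_of, simp)
  have \<B>s: "B \<in> sets borel" if "B \<in> \<B>" for B
    unfolding sB using that by (rule sigma_sets.Basic)
  have p: "\<kappa> \<in> borel \<rightarrow>\<^sub>M prob_algebra borel" "\<kappa>' \<in> borel \<rightarrow>\<^sub>M prob_algebra borel"
    using k1 k2 unfolding regular_cond_distr_def by blast+
  note m[measurable] = p[THEN measurable_prob_algebraD]
  have ps: "prob_space (\<kappa> v)" "sets (\<kappa> v) = sets borel" "prob_space (\<kappa>' v)" "sets (\<kappa>' v) = sets borel" for v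
    using measurable_space[OF p(1), of v] measurable_space[OF p(2), of v]
    by (simp_all add: space_prob_algebra)
  have "AE v in distr M borel Z. emeasure (\<kappa> v) B = emeasure (\<kappa>' v) B" if B[measurable]: "B \<in> sets borel" for B
  proof (rule P.density_unique2)
    show "(\<lambda>v. emeasure (\<kappa> v) B) \<in> borel_measurable (distr M borel Z)"
      "(\<lambda>v. emeasure (\<kappa>' v) B) \<in> borel_measurable (distr M borel Z)" by measurable
    fix A assume "A \<in> sets (distr M borel Z)"
    then have A: "A \<in> sets borel" by simp
    have "emeasure M {\<omega>\<in>space M. Z \<omega> \<in> A \<and> Y \<omega> \<in> B} = (\<integral>\<^sup>+ v\<in>A. emeasure (\<kappa> v) B \<partial>distr M borel Z)"
      using k1[unfolded regular_cond_distr_def, THEN conjunct2, THEN bspec, OF A, THEN bspec, OF B] .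
    moreover have "emeasure M {\<omega>\<in>space M. Z \<omega> \<in> A \<and> Y \<omega> \<in> B} = (\<integral>\<^sup>+ v\<in>A. emeasure (\<kappa>' v) B \<partial>distr M borel Z)"
      using k2[unfolded regular_cond_distr_def, THEN conjunct2, THEN bspec, OF A, THEN bspec, OF B] .
    ultimately show "(\<integral>\<^sup>+ v\<in>A. emeasure (\<kappa> v) B \<partial>distr M borel Z) = (\<integral>\<^sup>+ v\<in>A. emeasure (\<kappa>' v) B \<partial>distr M borel Z)"
      by simp
  qed
  then have "AE v in distr M borel Z. \<forall>B\<in>\<B>. emeasure (\<kappa> v) B = emeasure (\<kappa>' v) B"
    using \<B>(1) \<B>s by (auto simp: AE_ball_countable)
  then obtain S where S: "S \<in> null_sets (distr M borel Z)"
    and eq: "{v \<in> space (distr M borel Z). \<not> (\<forall>B\<in>\<B>. emeasure (\<kappa> v) B = emeasure (\<kappa>' v) B)} \<subseteq> S"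
    by (auto simp: eventually_ae_filter)
  have "\<kappa> v = \<kappa>' v" if "v \<notin> S" for v
  proof (rule measure_eqI_generator_eq[where \<Omega>=UNIV and E=\<B> and A="\<lambda>_. UNIV"])
    interpret K: prob_space "\<kappa> v" by (rule ps)
    show "Int_stable \<B>" by fact
    show "sets (\<kappa> v) = sigma_sets UNIV \<B>" "sets (\<kappa>' v) = sigma_sets UNIV \<B>"
      using ps(2,4)[of v] sB by simp_all
    show "emeasure (\<kappa> v) B = emeasure (\<kappa>' v) B" if "B \<in> \<B>" for B using eq that \<open>v \<notin> S\<close> by auto
    show "emeasure (\<kappa> v) UNIV \<noteq> \<infinity>" for i :: nat by simp
    show "range (\<lambda>_. UNIV) \<subseteq> \<B>" using \<B>(3) by auto
  qed auto
  with S show thesis by (rule that)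
qed

lemma uniform_measure_distr:
  assumes h[measurable]: "h \<in> M \<rightarrow>\<^sub>M N" and C[measurable]: "C \<in> sets N"
  shows "uniform_measure (distr M N h) C = distr (uniform_measure M (h -` C \<inter> space M)) N h"
proof (rule measure_eqI)
  fix B assume "B \<in> sets (uniform_measure (distr M N h) C)"
  then have B[measurable]: "B \<in> sets N" by simp
  have "h -` (C \<inter> B) \<inter> space M = (h -` C \<inter> space M) \<inter> (h -` B \<inter> space M)" by auto
  then show "emeasure (uniform_measure (distr M N h) C) B = emeasure (distr (uniform_measure M (h -` C \<inter> space M)) N h) B"
    by (simp add: emeasure_distr)
qed simp

lemma uniform_measure_times_space:
  assumes "prob_space P" "prob_space Q" and A[measurable]: "A \<in> sets P" and A0: "emeasure P A \<noteq> 0"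
  shows "uniform_measure (P \<Otimes>\<^sub>M Q) (A \<times> space Q) = uniform_measure P A \<Otimes>\<^sub>M Q"
proof (rule pair_measure_eqI[symmetric])
  interpret P: prob_space P by fact
  interpret Q: prob_space Q by fact
  interpret U: prob_space "uniform_measure P A"
    by (rule prob_space_uniform_measure) (use A0 in auto)
  show "sigma_finite_measure (uniform_measure P A)" "sigma_finite_measure Q" by unfold_locales
  show "sets (uniform_measure P A \<Otimes>\<^sub>M Q) = sets (uniform_measure (P \<Otimes>\<^sub>M Q) (A \<times> space Q))"
    by (simp cong: sets_pair_measure_cong)
  fix B C assume "B \<in> sets (uniform_measure P A)" and C: "C \<in> sets Q"
  then have [measurable]: "B \<in> sets P" "C \<in> sets Q" by auto
  have *: "(A \<times> space Q) \<inter> (B \<times> C) = (A \<inter> B) \<times> C" using sets.sets_into_space[OF C] by auto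
  show "emeasure (uniform_measure P A) B * emeasure Q C = emeasure (uniform_measure (P \<Otimes>\<^sub>M Q) (A \<times> space Q)) (B \<times> C)"
    by (simp add: * Q.emeasure_pair_measure_Times Q.emeasure_space_1 ennreal_times_divide mult.commute)
qed

text \<open>
  A continuous mapping theorem with an independent parameter \<open>w\<close> and with functions that vary with \<open>n\<close>.
  Skorohod's representation replaces weak convergence by pointwise convergence on one probability
  space, and dominated convergence on its product with \<open>Q\<close> finishes the argument.
\<close>
lemma weak_conv_m_product_integral:
  fixes \<mu> :: "nat \<Rightarrow> real measure" and g :: "nat \<Rightarrow> real \<times> 'b \<Rightarrow> real"
  assumes \<mu>: "\<And>n. real_distribution (\<mu> n)" and L: "real_distribution L" and conv: "weak_conv_m \<mu> L"
    and Q: "prob_space Q"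
    and gm[measurable]: "\<And>n. g n \<in> borel_measurable (borel \<Otimes>\<^sub>M Q)" and hm[measurable]: "h \<in> borel_measurable (borel \<Otimes>\<^sub>M Q)"
    and bound: "\<And>n p. \<bar>g n p\<bar> \<le> B"
    and lim: "\<And>e e' w. w \<in> space Q \<Longrightarrow> e \<longlonglongrightarrow> e' \<Longrightarrow> (\<lambda>n. g n (e n, w)) \<longlonglongrightarrow> h (e', w)"
  shows "(\<lambda>n. \<integral>p. g n p \<partial>(\<mu> n \<Otimes>\<^sub>M Q)) \<longlonglongrightarrow> (\<integral>p. h p \<partial>(L \<Otimes>\<^sub>M Q))"
proof -
  interpret Q: prob_space Q by fact
  obtain \<Omega> :: "real measure" and Y_seq Y where \<Omega>: "prob_space \<Omega>"
    and Ym[measurable]: "\<And>n. Y_seq n \<in> borel_measurable \<Omega>" and Yd: "\<And>n. distr \<Omega> borel (Y_seq n) = \<mu> n"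
    and Ym'[measurable]: "Y \<in> borel_measurable \<Omega>" and Yd': "distr \<Omega> borel Y = L"
    and Ylim: "\<And>x. x \<in> space \<Omega> \<Longrightarrow> (\<lambda>n. Y_seq n x) \<longlonglongrightarrow> Y x"
    using Skorohod[OF \<mu> L conv] by force
  interpret \<Omega>: prob_space \<Omega> by fact
  interpret \<Omega>Q: pair_prob_space \<Omega> Q ..
  have push: "(\<integral>p. k p \<partial>(distr \<Omega> borel V \<Otimes>\<^sub>M Q)) = (\<integral>p. k (V (fst p), snd p) \<partial>(\<Omega> \<Otimes>\<^sub>M Q))"
    if [measurable]: "V \<in> borel_measurable \<Omega>" "k \<in> borel_measurable (borel \<Otimes>\<^sub>M Q)" for V :: "real \<Rightarrow> real" and k :: "real \<times> 'b \<Rightarrow> real"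
  proof -
    have "distr \<Omega> borel V \<Otimes>\<^sub>M Q = distr \<Omega> borel V \<Otimes>\<^sub>M distr Q Q (\<lambda>x. x)" by (simp add: distr_id)
    also have "\<dots> = distr (\<Omega> \<Otimes>\<^sub>M Q) (borel \<Otimes>\<^sub>M Q) (\<lambda>(x, w). (V x, w))"
      by (rule pair_measure_distr) (auto simp: distr_id Q.sigma_finite_measure_axioms)
    finally show ?thesis by (simp add: integral_distr split_beta)
  qed
  have "(\<lambda>n. \<integral>p. g n (Y_seq n (fst p), snd p) \<partial>(\<Omega> \<Otimes>\<^sub>M Q)) \<longlonglongrightarrow> (\<integral>p. h (Y (fst p), snd p) \<partial>(\<Omega> \<Otimes>\<^sub>M Q))"
  proof (rule integral_dominated_convergence[where w="\<lambda>_. B"])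
    show "AE p in \<Omega> \<Otimes>\<^sub>M Q. (\<lambda>n. g n (Y_seq n (fst p), snd p)) \<longlonglongrightarrow> h (Y (fst p), snd p)"
      by (intro AE_I2 lim Ylim) (auto simp: space_pair_measure)
  qed (use bound in auto)
  then show ?thesis
    by (simp add: push Yd[symmetric] Yd'[symmetric])
qed

section \<open>Limit given the exact value\<close>

lemma normalize_risk_measurable[measurable]: "normalize_risk \<rho> v \<in> borel_measurable borel"
  unfolding normalize_risk_def divide_inverse by (intro borel_measurable_continuous_onI continuous_intros)

lemma vec_cons_continuous: "continuous_on UNIV (\<lambda>p :: real \<times> (real^'k::finite). vec_cons (fst p) (snd p))"
  unfolding vec_cons_def
proof (intro continuous_intros)
  fix i :: "'k option"
  show "continuous_on UNIV (\<lambda>p :: real \<times> (real^'k). case i of None \<Rightarrow> fst p | Some l \<Rightarrow> snd p $ l)"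
    by (cases i) (auto intro!: continuous_intros)
qed

lemma vec_cons_measurable[measurable (raw)]:
  fixes g :: "'a \<Rightarrow> real^'k::finite"
  assumes f[measurable]: "f \<in> borel_measurable M" and g[measurable]: "g \<in> borel_measurable M"
  shows "(\<lambda>x. vec_cons (f x) (g x)) \<in> borel_measurable M"
proof -
  have m: "(\<lambda>p :: real \<times> (real^'k). vec_cons (fst p) (snd p)) \<in> borel \<Otimes>\<^sub>M borel \<rightarrow>\<^sub>M borel"
    unfolding borel_prod by (rule borel_measurable_continuous_onI[OF vec_cons_continuous])
  have "(\<lambda>x. (f x, g x)) \<in> M \<rightarrow>\<^sub>M borel \<Otimes>\<^sub>M borel" by simp
  from measurable_compose[OF this m] show ?thesis by simp
qed

lemma tendsto_vec_cons:
  fixes g :: "'a \<Rightarrow> real^'k::finite"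
  assumes "(f \<longlongrightarrow> a) F" "(g \<longlongrightarrow> b) F"
  shows "((\<lambda>x. vec_cons (f x) (g x)) \<longlongrightarrow> vec_cons a b) F"
proof -
  have "isCont (\<lambda>p :: real \<times> (real^'k). vec_cons (fst p) (snd p)) (a, b)"
    using vec_cons_continuous unfolding continuous_on_eq_continuous_at[OF open_UNIV] by blast
  from isCont_tendsto_compose[OF this tendsto_Pair[OF assms]] show ?thesis by simp
qed

text \<open>
  Written in terms of the overshoot \<open>x\<close> over the level \<open>v\<close>: the deterministic shift, the Gaussian part
  and the noise sum of squares, whose factor \<open>1 / sqrt v\<close> makes it vanish in the limit.
\<close>
lemma normalize_radial_tail:
  assumes "v > 0" "\<rho> $ j \<noteq> 0"
  shows "normalize_risk \<rho> v (radial_tail i0 \<rho> (v + x) w) $ j =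
    \<rho> $ j * (x * inverse (sqrt v)) / 2 + sqrt (1 + x * inverse v) * w $ i0 $ j +
    (\<Sum>i\<in>UNIV. (w $ i $ j)\<^sup>2) / (2 * \<rho> $ j) * inverse (sqrt v)"
proof -
  have s: "sqrt (v + x) = sqrt v * sqrt (1 + x * inverse v)"
    using assms by (simp add: real_sqrt_mult[symmetric] field_simps)
  show ?thesis
    unfolding normalize_risk_def radial_tail_def s using assms
    by (simp add: field_simps power2_eq_square)
qed

text \<open>
  The joint law is the image of a product measure that keeps the first coordinate, so fixing that
  coordinate gives a kernel explicitly, defined and measurable for all \<open>v\<close>.
\<close>
lemma regular_cond_distr_radial:
  fixes X :: "'w \<Rightarrow> real^('k::finite option)^'m::finite" and i0 :: 'm
  assumes risk: "perturbed_representation M \<rho> X W" and A: "assumption_A M \<gamma> X W"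
  shows "regular_cond_distr M (\<lambda>\<omega>. chi_square_risk X \<omega> $ None) (\<lambda>\<omega>. vec_tl (chi_square_risk X \<omega>))
     (\<lambda>v. distr (distr M borel W) borel (radial_tail i0 \<rho> v))"
  unfolding regular_cond_distr_def
proof (intro conjI ballI)
  interpret prob_space M using risk by (simp add: perturbed_representation_def)
  have X: "X \<in> borel_measurable M" and W[measurable]: "W \<in> borel_measurable M"
    using risk by (auto simp: perturbed_representation_def)
  interpret PW: prob_space "distr M borel W" by (rule prob_space_distr) simp
  define Z where "Z = (\<lambda>\<omega>. chi_square_risk X \<omega> $ None)"
  define Y where "Y = (\<lambda>\<omega>. vec_tl (chi_square_risk X \<omega>))"
  have Z[measurable]: "Z \<in> borel_measurable M" unfolding Z_def
    by (intro measurable_compose[OF borel_measurable_chi_square_risk[OF X]] borel_measurable_continuous_onI continuous_intros)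
  have Y[measurable]: "Y \<in> borel_measurable M" unfolding Y_def
    by (intro measurable_compose[OF borel_measurable_chi_square_risk[OF X]] borel_measurable_continuous_onI vec_tl_continuous)
  show "(\<lambda>v. distr (distr M borel W) borel (radial_tail i0 \<rho> v)) \<in> borel \<rightarrow>\<^sub>M prob_algebra borel"
  proof (rule measurable_prob_algebraI)
    show "prob_space (distr (distr M borel W) borel (radial_tail i0 \<rho> v))" for v
      by (rule PW.prob_space_distr) simp
    show "(\<lambda>v. distr (distr M borel W) borel (radial_tail i0 \<rho> v)) \<in> borel \<rightarrow>\<^sub>M subprob_algebra borel"
    proof (rule measurable_distr2)
      show "case_prod (radial_tail i0 \<rho>) \<in> borel \<Otimes>\<^sub>M borel \<rightarrow>\<^sub>M borel" by measurable
      show "(\<lambda>v. distr M borel W) \<in> borel \<rightarrow>\<^sub>M subprob_algebra borel"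
        by (rule measurable_const) (simp add: space_subprob_algebra PW.subprob_space_axioms)
    qed
  qed
  fix A B :: "_ set" assume [measurable]: "A \<in> sets (borel :: real measure)" "B \<in> sets (borel :: (real^'k) measure)"
  have "emeasure M {\<omega> \<in> space M. Z \<omega> \<in> A \<and> Y \<omega> \<in> B} = emeasure (distr M (borel \<Otimes>\<^sub>M borel) (\<lambda>\<omega>. (Z \<omega>, Y \<omega>))) (A \<times> B)"
    by (subst emeasure_distr) (auto intro!: arg_cong[where f="emeasure M"])
  also have "\<dots> = (\<integral>\<^sup>+p. indicator (A \<times> B) p \<partial>distr (distr M borel Z \<Otimes>\<^sub>M distr M borel W) (borel \<Otimes>\<^sub>M borel) (\<lambda>(z, w). (z, radial_tail i0 \<rho> z w)))"
    unfolding Z_def Y_def joint_law_radial[OF risk \<open>assumption_A M \<gamma> X W\<close>, of i0] by simp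
  also have "\<dots> = (\<integral>\<^sup>+p. indicator A (fst p) * indicator B (radial_tail i0 \<rho> (fst p) (snd p)) \<partial>(distr M borel Z \<Otimes>\<^sub>M distr M borel W))"
    by (subst nn_integral_distr) (auto simp: split_beta indicator_times)
  also have "\<dots> = (\<integral>\<^sup>+z. \<integral>\<^sup>+w. indicator A z * indicator B (radial_tail i0 \<rho> z w) \<partial>distr M borel W \<partial>distr M borel Z)"
    by (subst PW.nn_integral_fst[symmetric]) auto
  also have "\<dots> = (\<integral>\<^sup>+z\<in>A. emeasure (distr (distr M borel W) borel (radial_tail i0 \<rho> z)) B \<partial>distr M borel Z)"
  proof (rule nn_integral_cong)
    fix z
    have "emeasure (distr (distr M borel W) borel (radial_tail i0 \<rho> z)) B = (\<integral>\<^sup>+w. indicator B (radial_tail i0 \<rho> z w) \<partial>distr M borel W)"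
      by (subst nn_integral_indicator[symmetric], simp, subst nn_integral_distr) auto
    then show "(\<integral>\<^sup>+w. indicator A z * indicator B (radial_tail i0 \<rho> z w) \<partial>distr M borel W)
       = emeasure (distr (distr M borel W) borel (radial_tail i0 \<rho> z)) B * indicator A z"
      by (subst nn_integral_cmult) (auto simp: mult.commute)
  qed
  finally show "emeasure M {\<omega> \<in> space M. chi_square_risk X \<omega> $ None \<in> A \<and> vec_tl (chi_square_risk X \<omega>) \<in> B} =
     (\<integral>\<^sup>+z\<in>A. emeasure (distr (distr M borel W) borel (radial_tail i0 \<rho> z)) B \<partial>distr M borel (\<lambda>\<omega>. chi_square_risk X \<omega> $ None))"
    by (simp add: Z_def Y_def)
qed

text \<open>
  On the event \<open>\<zeta>\<^sub>1 = v\<close> there is no overshoot, so the integrand converges pointwise.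
\<close>
lemma radial_tail_conditional_limit:
  fixes \<rho> :: "real^'k::finite" and i0 :: "'m::finite" and Q :: "(real^'k^'m) measure"
  assumes "prob_space Q" and sQ[measurable_cong]: "sets Q = sets borel" and \<rho>: "\<And>j. \<rho> $ j \<noteq> 0"
    and f: "continuous_on UNIV f" "bounded (range f)"
  shows "((\<lambda>v. \<integral>w. f (normalize_risk \<rho> v (radial_tail i0 \<rho> v w)) \<partial>Q) \<longlongrightarrow> (\<integral>w. (f (w $ i0) :: real) \<partial>Q)) at_top"
proof -
  interpret Q: prob_space Q by fact
  obtain B where B: "\<And>x. norm (f x) \<le> B" using f(2) by (auto simp: bounded_iff)
  have [measurable]: "f \<in> borel_measurable borel" using f(1) by (rule borel_measurable_continuous_onI)
  have [measurable]: "(\<lambda>w::real^'k^'m. w $ i0) \<in> borel_measurable borel" 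
    by (intro borel_measurable_continuous_onI continuous_intros)
  show ?thesis
  proof (rule integral_dominated_convergence_at_top[where w="\<lambda>_. B"])
    show "AE w in Q. ((\<lambda>v. f (normalize_risk \<rho> v (radial_tail i0 \<rho> v w))) \<longlongrightarrow> f (w $ i0)) at_top"
    proof (intro AE_I2)
      fix w :: "real^'k^'m"
      have "((\<lambda>v. normalize_risk \<rho> v (radial_tail i0 \<rho> v w)) \<longlongrightarrow> w $ i0) at_top"
      proof (rule vec_tendstoI)
        fix j
        have "((\<lambda>v. inverse (sqrt v)) \<longlongrightarrow> 0) at_top"
          by (rule tendsto_inverse_0_at_top[OF sqrt_at_top])
        then have "((\<lambda>v. \<rho> $ j * (0 * inverse (sqrt v)) / 2 + sqrt (1 + 0 * inverse v) * w $ i0 $ j +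
            (\<Sum>i\<in>UNIV. (w $ i $ j)\<^sup>2) / (2 * \<rho> $ j) * inverse (sqrt v)) \<longlongrightarrow>
            0 + w $ i0 $ j + (\<Sum>i\<in>UNIV. (w $ i $ j)\<^sup>2) / (2 * \<rho> $ j) * 0) at_top"
          by (intro tendsto_add tendsto_mult tendsto_const) auto
        then show "((\<lambda>v. normalize_risk \<rho> v (radial_tail i0 \<rho> v w) $ j) \<longlongrightarrow> w $ i0 $ j) at_top"
          using \<rho>[of j] normalize_radial_tail[of _ \<rho> j i0 0 w]
          by (auto elim!: Lim_transform_eventually intro!: eventually_mono[OF eventually_gt_at_top[of 0]])
      qed
      moreover have "isCont f (w $ i0)" using f(1) by (simp add: continuous_on_eq_continuous_at)
      ultimately show "((\<lambda>v. f (normalize_risk \<rho> v (radial_tail i0 \<rho> v w))) \<longlongrightarrow> f (w $ i0)) at_top"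
        by (rule isCont_tendsto_compose[rotated])
    qed
  qed (use B in \<open>auto\<close>)
qed

text \<open>
  The explicit kernel converges along all \<open>v\<close>, and every other kernel agrees with it off a null set.
\<close>
lemma converges_given_value_chi_square:
  fixes X :: "'w \<Rightarrow> real^('k::finite option)^'m::finite"
  assumes risk: "perturbed_representation M \<rho> X W" and A: "assumption_A M \<gamma> X W"
  shows "converges_given_value M (\<lambda>\<omega>. chi_square_risk X \<omega> $ None)
           (\<lambda>\<omega>. vec_tl (chi_square_risk X \<omega>)) (normalize_risk \<rho>) \<gamma>"
proof -
  interpret prob_space M using risk by (simp add: perturbed_representation_def)
  have X: "X \<in> borel_measurable M" and W[measurable]: "W \<in> borel_measurable M" and \<rho>: "\<And>j. \<rho> $ j \<noteq> 0"
    using risk by (auto simp: perturbed_representation_def)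
  define Z where "Z = (\<lambda>\<omega>. chi_square_risk X \<omega> $ None)"
  define Y where "Y = (\<lambda>\<omega>. vec_tl (chi_square_risk X \<omega>))"
  have Z[measurable]: "Z \<in> borel_measurable M" unfolding Z_def
    by (intro measurable_compose[OF borel_measurable_chi_square_risk[OF X]] borel_measurable_continuous_onI continuous_intros)
  \<comment> \<open>All rows of the noise have the same law, so any row can serve.\<close>
  define i0 :: 'm where "i0 = undefined"
  define \<kappa> where "\<kappa> v = distr (distr M borel W) borel (radial_tail i0 \<rho> v)" for v
  have \<kappa>: "regular_cond_distr M Z Y \<kappa>"
    unfolding Z_def Y_def \<kappa>_def by (rule regular_cond_distr_radial[OF risk A])
  have row: "distr (distr M borel W) borel (\<lambda>w. w $ i0) = \<gamma>"
  proof -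
    have "(\<lambda>w::real^'k^'m. w $ i0) \<in> borel_measurable borel" 
      by (intro borel_measurable_continuous_onI continuous_intros)
    then show ?thesis using A by (subst distr_distr) (auto simp: assumption_A_def comp_def)
  qed
  have lim: "((\<lambda>v. \<integral>x. f x \<partial>distr (\<kappa> v) borel (normalize_risk \<rho> v)) \<longlongrightarrow> (\<integral>x. f x \<partial>\<gamma>)) at_top"
    if f: "continuous_on UNIV f" "bounded (range f)" for f :: "real^'k \<Rightarrow> real"
  proof -
    have [measurable]: "f \<in> borel_measurable borel" using f(1) by (rule borel_measurable_continuous_onI)
    have [measurable]: "(\<lambda>w::real^'k^'m. w $ i0) \<in> borel_measurable borel" 
      by (intro borel_measurable_continuous_onI continuous_intros)
    have "(\<integral>x. f x \<partial>distr (\<kappa> v) borel (normalize_risk \<rho> v)) = (\<integral>w. f (normalize_risk \<rho> v (radial_tail i0 \<rho> v w)) \<partial>distr M borel W)" for v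
      unfolding \<kappa>_def by (subst integral_distr, simp, simp, subst integral_distr) auto
    moreover have "(\<integral>x. f x \<partial>\<gamma>) = (\<integral>w. f (w $ i0) \<partial>distr M borel W)"
      unfolding row[symmetric] by (subst integral_distr) auto
    ultimately show ?thesis
      using radial_tail_conditional_limit[OF prob_space_distr[OF W] _ \<rho> f] by simp
  qed
  show ?thesis
    unfolding converges_given_value_def Z_def[symmetric] Y_def[symmetric]
  proof (intro conjI allI impI)
    show "\<exists>\<kappa>. regular_cond_distr M Z Y \<kappa>" using \<kappa> by blast
    fix \<kappa>' assume \<kappa>': "regular_cond_distr M Z Y \<kappa>'"
    obtain S where S: "S \<in> null_sets (distr M borel Z)" "\<And>v. v \<notin> S \<Longrightarrow> \<kappa> v = \<kappa>' v"
      by (rule regular_cond_distr_unique[OF prob_space_axioms Z \<kappa> \<kappa>']) blast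
    show "\<exists>S\<in>null_sets (distr M borel Z).
           converges_weakly (\<lambda>v. distr (\<kappa>' v) borel (normalize_risk \<rho> v)) \<gamma> (inf at_top (principal (- S)))"
    proof (rule bexI[OF _ S(1)], unfold converges_weakly_def, intro allI impI)
      fix f :: "real^'k \<Rightarrow> real" assume f: "continuous_on UNIV f \<and> bounded (range f)"
      have "((\<lambda>v. \<integral>x. f x \<partial>distr (\<kappa> v) borel (normalize_risk \<rho> v)) \<longlongrightarrow> (\<integral>x. f x \<partial>\<gamma>)) (inf at_top (principal (- S)))"
        by (rule tendsto_mono[OF inf_le1 lim]) (use f in auto)
      then show "((\<lambda>v. \<integral>x. f x \<partial>distr (\<kappa>' v) borel (normalize_risk \<rho> v)) \<longlongrightarrow> (\<integral>x. f x \<partial>\<gamma>)) (inf at_top (principal (- S)))"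
        by (rule Lim_transform_eventually) (use S(2) in \<open>auto simp: eventually_inf_principal\<close>)
    qed
  qed
qed

section \<open>Limit given an exceedance\<close>

text \<open>
  Were the tail zero from \<open>v\<close> on, the quotient at \<open>x = 0\<close> would be \<open>0 / 0 = 0\<close> eventually, and not tend to \<open>1\<close>.
  Hence all conditioning events \<open>Z > v\<close> have positive probability.
\<close>
lemma gumbel_mda_cdf_less_1:
  assumes P: "real_distribution P" and g: "gumbel_mda (cdf P) w"
  shows "cdf P v < 1"
proof (rule ccontr)
  interpret real_distribution P by fact
  assume "\<not> cdf P v < 1"
  then have "1 - cdf P u = 0" if "u \<ge> v" for u
    using cdf_nondecreasing[OF that] cdf_bounded_prob[of u] by linarith
  then have ev: "eventually (\<lambda>u. (1 - cdf P (u + 0 / w u)) / (1 - cdf P u) = 0) at_top"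
    by (intro eventually_mono[OF eventually_ge_at_top[of v]]) auto
  have "((\<lambda>u. (1 - cdf P (u + 0 / w u)) / (1 - cdf P u)) \<longlongrightarrow> exp (- 0)) at_top"
    using g unfolding gumbel_mda_def by blast
  from Lim_transform_eventually[OF this ev]
  have "((\<lambda>u::real. 0::real) \<longlongrightarrow> exp (- 0)) at_top" .
  then have "exp (- 0) = (0::real)" by (intro tendsto_unique[OF _ _ tendsto_const]) auto
  then show False by simp
qed

text \<open>
  For \<open>x \<ge> 0\<close> the distribution function of the scaled overshoot is one minus the quotient in the
  Gumbel condition; for \<open>x < 0\<close> it is zero because overshoots are positive.
\<close>
lemma exceedance_law_weak_conv_exponential:
  fixes P :: "real measure" and w :: "real \<Rightarrow> real"
  assumes P: "real_distribution P" and g: "gumbel_mda (cdf P) w" and s: "filterlim s at_top sequentially"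
    and E: "prob_space N" "distributed N lborel E (exponential_density 1)"
  defines "\<mu> \<equiv> \<lambda>v. distr (uniform_measure P {v<..}) borel (\<lambda>z. w v * (z - v))"
  shows "real_distribution (\<mu> v)" and "weak_conv_m (\<lambda>n. \<mu> (s n)) (distr N borel E)"
proof -
  interpret P: real_distribution P by fact
  interpret N: prob_space N by fact
  have tail: "measure P {v<..} = 1 - cdf P v" for v
    using P.prob_compl[of "{..v}"] by (simp add: cdf_def Compl_eq_Diff_UNIV[symmetric])
  have pos: "1 - cdf P v > 0" for v using gumbel_mda_cdf_less_1[OF P g, of v] by simp
  have ne: "emeasure P {v<..} \<noteq> 0" for v
    using pos[of v] by (simp add: P.emeasure_eq_measure tail)
  show rd: "real_distribution (\<mu> v)" for v
  proof -
    interpret U: prob_space "uniform_measure P {v<..}"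
      by (rule prob_space_uniform_measure[OF ne]) simp
    show ?thesis unfolding \<mu>_def by (intro real_distribution.intro U.prob_space_distr real_distribution_axioms.intro) auto
  qed
  have cdf\<mu>: "cdf (\<mu> v) x = (if x \<ge> 0 then 1 - (1 - cdf P (v + x / w v)) / (1 - cdf P v) else 0)"
    if v: "v > 0" for v x
  proof -
    have wv: "w v > 0" using g v by (simp add: gumbel_mda_def)
    have "cdf (\<mu> v) x = measure (uniform_measure P {v<..}) {z. w v * (z - v) \<le> x}"
      unfolding cdf_def \<mu>_def by (subst measure_distr) (auto intro!: arg_cong2[where f=measure])
    also have "\<dots> = measure P ({v<..} \<inter> {z. w v * (z - v) \<le> x}) / measure P {v<..}"
      by (rule measure_uniform_measure) (use ne in auto)
    also have "{v<..} \<inter> {z. w v * (z - v) \<le> x} = {v<..v + x / w v}"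
      using wv by (auto simp: field_simps)
    also have "measure P {v<..v + x / w v} / measure P {v<..} = (if x \<ge> 0 then 1 - (1 - cdf P (v + x / w v)) / (1 - cdf P v) else 0)"
    proof (cases "x > 0")
      case True
      then have "v < v + x / w v" using wv by simp
      then show ?thesis
        using True pos[of v] P.cdf_diff_eq[of v "v + x / w v"] by (simp add: tail field_simps)
    next
      case False
      then have "{v<..v + x / w v} = {}" using wv by (auto simp: divide_le_0_iff not_less)
      moreover have "x = 0 \<Longrightarrow> ?thesis" using pos[of v] by simp
      ultimately show ?thesis using False by (cases "x = 0") auto
    qed
    finally show ?thesis .
  qed
  have Em[measurable]: "E \<in> borel_measurable N" using distributed_measurable[OF E(2)] by simp
  have cdfE: "cdf (distr N borel E) x = (if x \<ge> 0 then 1 - exp (- x) else 0)" for x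
  proof -
    have m: "cdf (distr N borel E) x = \<P>(\<omega> in N. E \<omega> \<le> x)" for x
      unfolding cdf_def by (subst measure_distr) (auto intro!: arg_cong2[where f=measure])
    have "\<P>(\<omega> in N. E \<omega> \<le> x) = 1 - exp (- x)" if "x \<ge> 0" for x
      using N.exponential_distributedD_le[OF E(2) that] by simp
    from this[of x] this[of 0] show ?thesis
      using N.finite_measure_mono[of "{\<omega>\<in>space N. E \<omega> \<le> x}" "{\<omega>\<in>space N. E \<omega> \<le> 0}"]
        measure_nonneg[of N "{\<omega>\<in>space N. E \<omega> \<le> x}"]
      unfolding m by (cases "x \<ge> 0") (auto simp: Collect_mono_iff)
  qed
  show "weak_conv_m (\<lambda>n. \<mu> (s n)) (distr N borel E)"
    unfolding weak_conv_m_def weak_conv_def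
  proof (intro allI impI)
    fix x
    have "((\<lambda>v. (1 - cdf P (v + x / w v)) / (1 - cdf P v)) \<longlongrightarrow> exp (- x)) at_top"
      using g by (simp add: gumbel_mda_def)
    then have "((\<lambda>v. if x \<ge> 0 then 1 - (1 - cdf P (v + x / w v)) / (1 - cdf P v) else 0) \<longlongrightarrow> cdf (distr N borel E) x) at_top"
      unfolding cdfE by (auto intro!: tendsto_diff)
    then have "((\<lambda>v. cdf (\<mu> v) x) \<longlongrightarrow> cdf (distr N borel E) x) at_top"
      by (rule Lim_transform_eventually) (auto intro!: eventually_mono[OF eventually_gt_at_top[of 0]] simp: cdf\<mu>)
    then show "(\<lambda>n. cdf (\<mu> (s n)) x) \<longlonglongrightarrow> cdf (distr N borel E) x"
      using s by (rule filterlim_compose)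
  qed
qed

text \<open>
  With \<open>e = w(v) (\<zeta>\<^sub>1 - v)\<close> the shift in coordinate \<open>j\<close> is \<open>\<rho>\<^sub>j e / (2 sqrt v w(v))\<close>, which tends
  to \<open>\<rho>\<^sub>j c e\<close>, and the Gaussian part is scaled by \<open>sqrt (1 + e / (v w(v)))\<close>, which tends to \<open>1\<close>.
  Given \<open>\<zeta>\<^sub>1 > v\<close> the noise keeps its law and stays independent of \<open>e\<close>, and \<open>e\<close> becomes exponential.
\<close>
lemma converges_given_exceedance_chi_square:
  fixes X :: "'w \<Rightarrow> real^('k::finite option)^'m::finite" and U :: "'u \<Rightarrow> real^'k"
  assumes risk: "perturbed_representation M \<rho> X W" and A: "assumption_A M \<gamma> X W"
    and N: "prob_space N" "U \<in> borel_measurable N" "distr N borel U = \<gamma>"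
    and g: "gumbel_mda (risk_cdf M X) w"
    and c: "((\<lambda>v. inverse (sqrt v * w v)) \<longlongrightarrow> 2 * c) at_top"
    and E: "distributed N lborel E (exponential_density 1)" and ind: "indep_vectors N E U"
  shows "converges_given_exceedance M (\<lambda>\<omega>. chi_square_risk X \<omega> $ None)
             (\<lambda>v \<omega>. vec_cons (w v * (chi_square_risk X \<omega> $ None - v))
                             (normalize_risk \<rho> v (vec_tl (chi_square_risk X \<omega>))))
             (distr N borel (\<lambda>\<omega>. vec_cons (E \<omega>) (\<chi> j. \<rho> $ j * c * E \<omega> + U \<omega> $ j)))"
  unfolding converges_given_exceedance_def converges_weakly_def
proof (intro allI impI)
  fix f :: "real^('k option) \<Rightarrow> real" assume "continuous_on UNIV f \<and> bounded (range f)"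
  then have f: "continuous_on UNIV f" "bounded (range f)" by auto
  obtain B where B: "\<And>x. \<bar>f x\<bar> \<le> B" using f(2) by (auto simp: bounded_iff)
  have fm[measurable]: "f \<in> borel_measurable borel" using f(1) by (rule borel_measurable_continuous_onI)
  interpret prob_space M using risk by (simp add: perturbed_representation_def)
  interpret N: prob_space N by fact
  have X: "X \<in> borel_measurable M" and W[measurable]: "W \<in> borel_measurable M" and \<rho>: "\<And>j. \<rho> $ j \<noteq> 0"
    using risk by (auto simp: perturbed_representation_def)
  have Em[measurable]: "E \<in> borel_measurable N" using distributed_measurable[OF E] by simp
  note Um[measurable] = N(2)
  \<comment> \<open>All rows of the noise have the same law, so any row can serve.\<close>
  define i0 :: 'm where "i0 = undefined"
  have im[measurable]: "(\<lambda>w::real^'k^'m. w $ i0) \<in> borel_measurable borel" 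
    by (intro borel_measurable_continuous_onI continuous_intros)
  define Z where "Z = (\<lambda>\<omega>. chi_square_risk X \<omega> $ None)"
  define Y where "Y = (\<lambda>\<omega>. vec_tl (chi_square_risk X \<omega>))"
  define P where "P = distr M borel Z"
  define Q where "Q = distr M borel W"
  have Z[measurable]: "Z \<in> borel_measurable M" unfolding Z_def
    by (intro measurable_compose[OF borel_measurable_chi_square_risk[OF X]] borel_measurable_continuous_onI continuous_intros)
  have Y[measurable]: "Y \<in> borel_measurable M" unfolding Y_def
    by (intro measurable_compose[OF borel_measurable_chi_square_risk[OF X]] borel_measurable_continuous_onI vec_tl_continuous)
  have sQ[measurable_cong]: "sets Q = sets borel" and sP[measurable_cong]: "sets P = sets borel"
    by (simp_all add: Q_def P_def)
  have spQ: "space Q = UNIV" and spP: "space P = UNIV" by (simp_all add: Q_def P_def)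
  interpret Q: prob_space Q unfolding Q_def by (rule prob_space_distr) simp
  have P: "real_distribution P"
    unfolding P_def by (intro real_distribution.intro prob_space_distr real_distribution_axioms.intro) auto
  interpret P: real_distribution P by fact
  have g': "gumbel_mda (cdf P) w" using g by (simp add: risk_cdf_def P_def Z_def)
  define \<Psi> where "\<Psi> = (\<lambda>(z, x). (z, radial_tail i0 \<rho> z x))"
  have \<Psi>m[measurable]: "\<Psi> \<in> borel \<Otimes>\<^sub>M borel \<rightarrow>\<^sub>M borel \<Otimes>\<^sub>M borel"
    unfolding \<Psi>_def by measurable
  have joint: "distr M (borel \<Otimes>\<^sub>M borel) (\<lambda>\<omega>. (Z \<omega>, Y \<omega>)) = distr (P \<Otimes>\<^sub>M Q) (borel \<Otimes>\<^sub>M borel) \<Psi>"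
    unfolding P_def Q_def \<Psi>_def Z_def Y_def by (rule joint_law_radial[OF risk A])
  have ne: "emeasure P {v<..} \<noteq> 0" for v
    using gumbel_mda_cdf_less_1[OF P g', of v] P.prob_compl[of "{..v}"]
    by (simp add: P.emeasure_eq_measure cdf_def Compl_eq_Diff_UNIV[symmetric])
  define H where "H v p = vec_cons (w v * (fst p - v)) (normalize_risk \<rho> v (snd p))" for v :: real and p :: "real \<times> (real^'k)"
  have Hm[measurable]: "H v \<in> borel \<Otimes>\<^sub>M borel \<rightarrow>\<^sub>M borel" for v
    unfolding H_def by measurable
  define \<mu> where "\<mu> v = distr (uniform_measure P {v<..}) borel (\<lambda>z. w v * (z - v))" for v
  define G where "G v p = f (vec_cons (fst p) (normalize_risk \<rho> v (radial_tail i0 \<rho> (v + fst p / w v) (snd p))))"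
    for v :: real and p :: "real \<times> (real^'k^'m)"
  have Gm[measurable]: "G v \<in> borel_measurable (borel \<Otimes>\<^sub>M Q)" for v
    unfolding G_def by measurable
  \<comment> \<open>\<open>G v\<close> is the test function of the normalized risk in terms of the scaled overshoot and the noise.\<close>
  have cond: "(\<integral>x. f x \<partial>distr (uniform_measure M {\<omega>\<in>space M. v < Z \<omega>}) borel (\<lambda>\<omega>. H v (Z \<omega>, Y \<omega>))) = (\<integral>p. G v p \<partial>(\<mu> v \<Otimes>\<^sub>M Q))"
    if v: "v > 0" for v
  proof -
    have wv: "w v > 0" using g v by (simp add: gumbel_mda_def)
    have s1: "{\<omega>\<in>space M. v < Z \<omega>} = (\<lambda>\<omega>. (Z \<omega>, Y \<omega>)) -` ({v<..} \<times> UNIV) \<inter> space M" by auto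
    have s2: "\<Psi> -` ({v<..} \<times> UNIV) \<inter> space (P \<Otimes>\<^sub>M Q) = {v<..} \<times> space Q"
      by (auto simp: \<Psi>_def space_pair_measure spP spQ)
    have "(\<integral>x. f x \<partial>distr (uniform_measure M {\<omega>\<in>space M. v < Z \<omega>}) borel (\<lambda>\<omega>. H v (Z \<omega>, Y \<omega>)))
      = (\<integral>p. f (H v p) \<partial>distr (uniform_measure M {\<omega>\<in>space M. v < Z \<omega>}) (borel \<Otimes>\<^sub>M borel) (\<lambda>\<omega>. (Z \<omega>, Y \<omega>)))"
      by (subst (1 2) integral_distr) auto
    also have "\<dots> = (\<integral>p. f (H v p) \<partial>uniform_measure (distr M (borel \<Otimes>\<^sub>M borel) (\<lambda>\<omega>. (Z \<omega>, Y \<omega>))) ({v<..} \<times> UNIV))"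
      unfolding s1 by (subst uniform_measure_distr) auto
    also have "\<dots> = (\<integral>p. f (H v p) \<partial>distr (uniform_measure P {v<..} \<Otimes>\<^sub>M Q) (borel \<Otimes>\<^sub>M borel) \<Psi>)"
      unfolding joint
      by (subst uniform_measure_distr) (auto simp: s2 uniform_measure_times_space[OF P.prob_space_axioms Q.prob_space_axioms _ ne])
    also have "\<dots> = (\<integral>p. f (H v (\<Psi> p)) \<partial>(uniform_measure P {v<..} \<Otimes>\<^sub>M Q))"
      by (subst integral_distr) auto
    also have "\<dots> = (\<integral>p. G v (w v * (fst p - v), snd p) \<partial>(uniform_measure P {v<..} \<Otimes>\<^sub>M Q))"
      using wv by (intro Bochner_Integration.integral_cong refl) (auto simp: G_def H_def \<Psi>_def)
    also have "\<dots> = (\<integral>p. G v p \<partial>distr (uniform_measure P {v<..} \<Otimes>\<^sub>M Q) (borel \<Otimes>\<^sub>M Q) (\<lambda>(z, x). (w v * (z - v), x)))"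
      by (subst integral_distr) (auto simp: split_beta)
    also have "distr (uniform_measure P {v<..} \<Otimes>\<^sub>M Q) (borel \<Otimes>\<^sub>M Q) (\<lambda>(z, x). (w v * (z - v), x)) = \<mu> v \<Otimes>\<^sub>M distr Q Q (\<lambda>x. x)"
      unfolding \<mu>_def by (rule pair_measure_distr[symmetric]) (auto simp: distr_id Q.sigma_finite_measure_axioms)
    finally show ?thesis by (simp add: distr_id)
  qed
  define h where "h p = f (vec_cons (fst p) (\<chi> j. \<rho> $ j * c * fst p + snd p $ j))" for p :: "real \<times> (real^'k)"
  have "continuous_on UNIV (\<lambda>p :: real \<times> (real^'k). (\<chi> j. \<rho> $ j * c * fst p + snd p $ j))"
    by (intro continuous_intros)
  then have [measurable]: "(\<lambda>p :: real \<times> (real^'k). (\<chi> j. \<rho> $ j * c * fst p + snd p $ j)) \<in> borel \<Otimes>\<^sub>M borel \<rightarrow>\<^sub>M borel"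
    unfolding borel_prod by (rule borel_measurable_continuous_onI)
  have hm[measurable]: "h \<in> borel_measurable (borel \<Otimes>\<^sub>M borel)" unfolding h_def by measurable
  \<comment> \<open>A row of the noise has the law of \<open>U\<close> and can replace it next to an independent \<open>E\<close>.\<close>
  have limit: "(\<integral>x. f x \<partial>distr N borel (\<lambda>\<omega>. vec_cons (E \<omega>) (\<chi> j. \<rho> $ j * c * E \<omega> + U \<omega> $ j)))
     = (\<integral>p. h (fst p, snd p $ i0) \<partial>(distr N borel E \<Otimes>\<^sub>M Q))"
  proof -
    have row: "distr Q borel (\<lambda>w. w $ i0) = distr N borel U"
      using A N(3) unfolding Q_def by (subst distr_distr) (auto simp: assumption_A_def comp_def)
    interpret NE: prob_space "distr N borel E" by (rule N.prob_space_distr) simp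
    interpret NU: prob_space "distr N borel U" by (rule N.prob_space_distr) simp
    have m': "(\<lambda>\<omega>. vec_cons (E \<omega>) (\<chi> j. \<rho> $ j * c * E \<omega> + U \<omega> $ j)) \<in> borel_measurable N"
      using measurable_compose[of "\<lambda>\<omega>. (E \<omega>, U \<omega>)" N "borel \<Otimes>\<^sub>M borel" "\<lambda>p. (\<chi> j. \<rho> $ j * c * fst p + snd p $ j)" borel]
      by (intro vec_cons_measurable) auto
    have "(\<integral>x. f x \<partial>distr N borel (\<lambda>\<omega>. vec_cons (E \<omega>) (\<chi> j. \<rho> $ j * c * E \<omega> + U \<omega> $ j))) = (\<integral>\<omega>. h (E \<omega>, U \<omega>) \<partial>N)"
      by (subst integral_distr) (auto simp: m' h_def)
    also have "\<dots> = (\<integral>p. h p \<partial>distr N (borel \<Otimes>\<^sub>M borel) (\<lambda>\<omega>. (E \<omega>, U \<omega>)))"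
      by (subst integral_distr) auto
    also have "\<dots> = (\<integral>p. h p \<partial>(distr N borel E \<Otimes>\<^sub>M distr N borel U))"
      by (subst distr_pair_indep_vectors[OF N(1) Em Um ind]) rule
    also have "distr N borel E \<Otimes>\<^sub>M distr N borel U = distr (distr N borel E) borel (\<lambda>x. x) \<Otimes>\<^sub>M distr Q borel (\<lambda>w. w $ i0)"
      unfolding row by (simp add: distr_id2)
    also have "\<dots> = distr (distr N borel E \<Otimes>\<^sub>M Q) (borel \<Otimes>\<^sub>M borel) (\<lambda>(e, x). (e, x $ i0))"
      by (rule pair_measure_distr) (auto simp: row NU.sigma_finite_measure_axioms)
    finally show ?thesis by (simp add: integral_distr split_beta)
  qed
  have main: "((\<lambda>v. \<integral>p. G v p \<partial>(\<mu> v \<Otimes>\<^sub>M Q)) \<longlongrightarrow> (\<integral>p. h (fst p, snd p $ i0) \<partial>(distr N borel E \<Otimes>\<^sub>M Q))) at_top"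
  proof (rule tendsto_at_topI_sequentially)
    fix s :: "nat \<Rightarrow> real" assume s: "filterlim s at_top sequentially"
    show "(\<lambda>n. \<integral>p. G (s n) p \<partial>(\<mu> (s n) \<Otimes>\<^sub>M Q)) \<longlonglongrightarrow> (\<integral>p. h (fst p, snd p $ i0) \<partial>(distr N borel E \<Otimes>\<^sub>M Q))"
    proof (rule weak_conv_m_product_integral[where B=B])
      show "real_distribution (\<mu> (s n))" for n
        unfolding \<mu>_def by (rule exceedance_law_weak_conv_exponential[OF P g' s N(1) E])
      show "weak_conv_m (\<lambda>n. \<mu> (s n)) (distr N borel E)"
        unfolding \<mu>_def by (rule exceedance_law_weak_conv_exponential[OF P g' s N(1) E])
      show "real_distribution (distr N borel E)"
        by (intro real_distribution.intro N.prob_space_distr real_distribution_axioms.intro) auto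
      show "\<bar>G (s n) p\<bar> \<le> B" for n p unfolding G_def by (rule B)
      show "prob_space Q" by (rule Q.prob_space_axioms)
      show "(\<lambda>n. G (s n) (e n, x)) \<longlonglongrightarrow> h (fst (e', x), snd (e', x) $ i0)"
        if e: "e \<longlonglongrightarrow> e'" for e e' and x :: "real^'k^'m"
      proof -
        have i0': "(\<lambda>n. inverse (sqrt (s n))) \<longlonglongrightarrow> 0"
          by (rule tendsto_inverse_0_at_top[OF filterlim_compose[OF sqrt_at_top s]])
        have ci: "(\<lambda>n. inverse (sqrt (s n) * w (s n))) \<longlonglongrightarrow> 2 * c"
          using c s by (rule filterlim_compose)
        have "(\<lambda>n. normalize_risk \<rho> (s n) (radial_tail i0 \<rho> (s n + e n / w (s n)) x)) \<longlonglongrightarrow> (\<chi> j. \<rho> $ j * c * e' + x $ i0 $ j)"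
        proof (rule vec_tendstoI)
          fix j
          have "(\<lambda>n. \<rho> $ j * (e n * inverse (sqrt (s n) * w (s n))) / 2
               + sqrt (1 + e n * inverse (sqrt (s n) * w (s n)) * inverse (sqrt (s n))) * x $ i0 $ j
               + (\<Sum>i\<in>UNIV. (x $ i $ j)\<^sup>2) / (2 * \<rho> $ j) * inverse (sqrt (s n))) \<longlonglongrightarrow>
               \<rho> $ j * (e' * (2 * c)) / 2 + sqrt (1 + e' * (2 * c) * 0) * x $ i0 $ j
               + (\<Sum>i\<in>UNIV. (x $ i $ j)\<^sup>2) / (2 * \<rho> $ j) * 0"
            by (intro tendsto_add tendsto_mult tendsto_divide tendsto_const tendsto_real_sqrt e ci i0') auto
          then have "(\<lambda>n. \<rho> $ j * (e n * inverse (sqrt (s n) * w (s n))) / 2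
               + sqrt (1 + e n * inverse (sqrt (s n) * w (s n)) * inverse (sqrt (s n))) * x $ i0 $ j
               + (\<Sum>i\<in>UNIV. (x $ i $ j)\<^sup>2) / (2 * \<rho> $ j) * inverse (sqrt (s n))) \<longlonglongrightarrow> (\<chi> j. \<rho> $ j * c * e' + x $ i0 $ j) $ j"
            by (simp add: mult_ac)
          moreover have "eventually (\<lambda>n. s n > 0) sequentially"
            using s by (simp add: filterlim_at_top_dense)
          then have "eventually (\<lambda>n. \<rho> $ j * (e n * inverse (sqrt (s n) * w (s n))) / 2
               + sqrt (1 + e n * inverse (sqrt (s n) * w (s n)) * inverse (sqrt (s n))) * x $ i0 $ j
               + (\<Sum>i\<in>UNIV. (x $ i $ j)\<^sup>2) / (2 * \<rho> $ j) * inverse (sqrt (s n))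
               = normalize_risk \<rho> (s n) (radial_tail i0 \<rho> (s n + e n / w (s n)) x) $ j) sequentially"
          proof eventually_elim
            fix n assume sn: "s n > 0"
            \<comment> \<open>Overshoot \<open>e / w\<close> over \<open>v\<close>: \<open>1 / (v w)\<close> is \<open>1 / (sqrt v w)\<close> times the vanishing \<open>1 / sqrt v\<close>.\<close>
            have "e n / w (s n) * inverse (sqrt (s n)) = e n * inverse (sqrt (s n) * w (s n))"
              "e n / w (s n) * inverse (s n) = e n * inverse (sqrt (s n) * w (s n)) * inverse (sqrt (s n))"
              using sn by (simp_all add: divide_inverse mult_ac flip: inverse_mult_distrib)
            then show "\<rho> $ j * (e n * inverse (sqrt (s n) * w (s n))) / 2
               + sqrt (1 + e n * inverse (sqrt (s n) * w (s n)) * inverse (sqrt (s n))) * x $ i0 $ j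
               + (\<Sum>i\<in>UNIV. (x $ i $ j)\<^sup>2) / (2 * \<rho> $ j) * inverse (sqrt (s n))
               = normalize_risk \<rho> (s n) (radial_tail i0 \<rho> (s n + e n / w (s n)) x) $ j"
              by (simp only: normalize_radial_tail[OF sn \<rho>])
          qed
          ultimately show "(\<lambda>n. normalize_risk \<rho> (s n) (radial_tail i0 \<rho> (s n + e n / w (s n)) x) $ j) \<longlonglongrightarrow> (\<chi> j. \<rho> $ j * c * e' + x $ i0 $ j) $ j"
            by (rule Lim_transform_eventually)
        qed
        from tendsto_vec_cons[OF e this]
        have "(\<lambda>n. vec_cons (e n) (normalize_risk \<rho> (s n) (radial_tail i0 \<rho> (s n + e n / w (s n)) x)))
           \<longlonglongrightarrow> vec_cons e' (\<chi> j. \<rho> $ j * c * e' + x $ i0 $ j)" .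
        moreover have "isCont f (vec_cons e' (\<chi> j. \<rho> $ j * c * e' + x $ i0 $ j))"
          using f(1) by (simp add: continuous_on_eq_continuous_at)
        ultimately have "(\<lambda>n. f (vec_cons (e n) (normalize_risk \<rho> (s n) (radial_tail i0 \<rho> (s n + e n / w (s n)) x))))
           \<longlonglongrightarrow> f (vec_cons e' (\<chi> j. \<rho> $ j * c * e' + x $ i0 $ j))"
          by (rule isCont_tendsto_compose[rotated])
        then show ?thesis by (simp add: G_def h_def)
      qed
    qed (measurable)
  qed
  have "((\<lambda>v. \<integral>x. f x \<partial>distr (uniform_measure M {\<omega>\<in>space M. v < Z \<omega>}) borel (\<lambda>\<omega>. H v (Z \<omega>, Y \<omega>)))
    \<longlongrightarrow> (\<integral>x. f x \<partial>distr N borel (\<lambda>\<omega>. vec_cons (E \<omega>) (\<chi> j. \<rho> $ j * c * E \<omega> + U \<omega> $ j)))) at_top"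
    unfolding limit
    by (rule Lim_transform_eventually[OF main]) (auto intro!: eventually_mono[OF eventually_gt_at_top[of 0]] simp: cond)
  then show "((\<lambda>v. \<integral>x. f x \<partial>distr (uniform_measure M {\<omega>\<in>space M. v < chi_square_risk X \<omega> $ None}) borel
         (\<lambda>\<omega>. vec_cons (w v * (chi_square_risk X \<omega> $ None - v)) (normalize_risk \<rho> v (vec_tl (chi_square_risk X \<omega>)))))
    \<longlongrightarrow> (\<integral>x. f x \<partial>distr N borel (\<lambda>\<omega>. vec_cons (E \<omega>) (\<chi> j. \<rho> $ j * c * E \<omega> + U \<omega> $ j)))) at_top"
    by (simp add: H_def Z_def Y_def)
qed

section \<open>Conditional limits of the perturbed chi-square risk\<close>

theorem theorem2p1:
  fixes M :: "'w measure" and N :: "'u measure"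
    and X :: "'w \<Rightarrow> real^('k::finite option)^'m::finite"
    and W :: "'w \<Rightarrow> real^'k^'m"
    and \<rho> :: "real^'k" and \<gamma> :: "(real^'k) measure"
    and U :: "'u \<Rightarrow> real^'k"
  assumes m: "CARD('m) \<ge> 2"
    and risk: "perturbed_representation M \<rho> X W"
    and A: "assumption_A M \<gamma> X W"
    and N: "prob_space N" "U \<in> borel_measurable N" "distr N borel U = \<gamma>"
  shows "converges_given_value M (\<lambda>\<omega>. chi_square_risk X \<omega> $ None)
           (\<lambda>\<omega>. vec_tl (chi_square_risk X \<omega>)) (normalize_risk \<rho>) (distr N borel U) \<and>
         (\<forall>(w :: real \<Rightarrow> real) (c :: real) (E :: 'u \<Rightarrow> real).
           gumbel_mda (risk_cdf M X) w \<longrightarrow>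
           c \<ge> 0 \<longrightarrow>
           ((\<lambda>v. inverse (sqrt v * w v)) \<longlongrightarrow> 2 * c) at_top \<longrightarrow>
           distributed N lborel E (exponential_density 1) \<longrightarrow>
           indep_vectors N E U \<longrightarrow>
           converges_given_exceedance M (\<lambda>\<omega>. chi_square_risk X \<omega> $ None)
             (\<lambda>v \<omega>. vec_cons (w v * (chi_square_risk X \<omega> $ None - v))
                             (normalize_risk \<rho> v (vec_tl (chi_square_risk X \<omega>))))
             (distr N borel (\<lambda>\<omega>. vec_cons (E \<omega>) (\<chi> j. \<rho> $ j * c * E \<omega> + U \<omega> $ j))))"
proof (intro conjI allI impI)
  show "converges_given_value M (\<lambda>\<omega>. chi_square_risk X \<omega> $ None)
           (\<lambda>\<omega>. vec_tl (chi_square_risk X \<omega>)) (normalize_risk \<rho>) (distr N borel U)"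
    unfolding N(3) by (rule converges_given_value_chi_square[OF risk A])
qed (rule converges_given_exceedance_chi_square[OF risk A N])

end
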